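(* Suppose $r=1$ or $r\ge\min(m,n)-2$. Then for every dependent set $\Omega\subseteq[m]\times[n]$ of the matroid $\mathcal{M}(r,[m]\times[n])$ both of the following hold. (a) There is a set $\mathcal{T}\subseteq[m]\times[n]$ such that $\operatorname{height}(I_{\mathcal{T}})>|\mathcal{T}\setminus\Omega|$. (b) There are $s\ge1$ and sets $\mathcal{I}_\alpha\times\mathcal{J}_\alpha\subseteq[m]\times[n]$ with $|\mathcal{I}_\alpha|>r$ and $|\mathcal{J}_\alpha|>r$, for $\alpha=1,\dots,s$, such that for each $1<\alpha\le s$ there are $\mathcal{I}'_\alpha\subseteq[m]$, $\mathcal{J}'_\alpha\subseteq[n]$ with $\min(|\mathcal{I}'_\alpha|,|\mathcal{J}'_\alpha|)\le r$ and $$(\mathcal{I}_\alpha\times\mathcal{J}_\alpha)\cap\Bigl(\bigcup_{k<\alpha}\mathcal{I}_k\times\mathcal{J}_k\Bigr)\subseteq\mathcal{I}'_\alpha\times\mathcal{J}'_\alpha,$$ and such that $$\left|\Bigl(\bigcup_{\alpha=1}^s\mathcal{I}_\alpha\times\mathcal{J}_\alpha\Bigr)\setminus\Omega\right|<\sum_{\alpha=1}^s(|\mathcal{I}_\alpha|-r)(|\mathcal{J}_\alpha|-r).$$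
   Context: $\Bbbk$ is an infinite field; $r,m,n$ are positive integers with $r<\min\{m,n\}$; $[m]=\{1,\dots,m\}$. $Z=(z_{ij})$ is an $m\times n$ matrix of variables and $I_{r+1}(Z)\subset\Bbbk[Z]$ is the (prime) ideal generated by all $(r+1)$-minors of $Z$. For $\Omega\subseteq[m]\times[n]$, $Z_\Omega=\{z_{ij}:(i,j)\in\Omega\}$. The determinantal matroid $\mathcal{M}(r,[m]\times[n])$ is the matroid on the ground set $[m]\times[n]$ in which $\Omega$ is independent if and only if $I_{r+1}(Z)\cap\Bbbk[Z_\Omega]=0$, and dependent otherwise. For $\mathcal{T}\subseteq[m]\times[n]$, $I_{\mathcal{T}}$ is the ideal of $\Bbbk[Z_{\mathcal{T}}]$ generated by those $(r+1)$-minors of $Z$ all of whose entries are in positions belonging to $\mathcal{T}$ (with height $0$ if there are none). *)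

theory Defs
  imports
    "HOL-Library.Poly_Mapping"
    "HOL-Library.Extended_Nat"
    "HOL-Algebra.Ideal"
    "Jordan_Normal_Form.Determinant"
begin

text \<open>A polynomial over \<open>'k\<close> in the variables \<open>'x\<close> maps each monomial (an exponent vector
  \<open>'x \<Rightarrow>\<^sub>0 nat\<close>) to its coefficient; multiplication is convolution.\<close>

type_synonym ('x, 'k) mpolynomial = "('x \<Rightarrow>\<^sub>0 nat) \<Rightarrow>\<^sub>0 'k"

definition mvar :: "'x \<Rightarrow> ('x, 'k::zero_neq_one) mpolynomial" where
  "mvar x = Poly_Mapping.single (Poly_Mapping.single x 1) 1"

definition mvars :: "('x, 'k::zero) mpolynomial \<Rightarrow> 'x set" where
  "mvars p = (\<Union>t\<in>Poly_Mapping.keys p. Poly_Mapping.keys t)"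

definition poly_ring_on :: "'x set \<Rightarrow> ('x, 'k::comm_ring_1) mpolynomial ring" where
  "poly_ring_on V =
     \<lparr>carrier = {p. mvars p \<subseteq> V}, monoid.mult = (*), one = 1, ring.zero = 0, add = (+)\<rparr>"

text \<open>Height of a prime: supremum of the lengths of chains of primes ending in it.  Height of an
  ideal: infimum of the heights of the primes containing it (so \<open>\<infinity>\<close> for the unit ideal).\<close>

definition prime_height :: "('a, 'b) ring_scheme \<Rightarrow> 'a set \<Rightarrow> enat" where
  "prime_height R P = Sup {enat l | l. \<exists>C :: nat \<Rightarrow> 'a set.
     (\<forall>i\<le>l. primeideal (C i) R) \<and> (\<forall>i<l. C i \<subset> C (Suc i)) \<and> C l = P}"

definition ideal_height :: "('a, 'b) ring_scheme \<Rightarrow> 'a set \<Rightarrow> enat" where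
  "ideal_height R I = Inf {prime_height R P | P. primeideal P R \<and> I \<subseteq> P}"

text \<open>The variable \<open>z\<^sub>i\<^sub>j\<close> is \<open>mvar (i, j)\<close>, with positions \<open>(i, j)\<close> counted from 1, whereas the
  matrices of the library are indexed from 0.  For finite \<open>I\<close>, \<open>J\<close> of the same size,
  \<open>generic_minor I J\<close> is the minor with rows \<open>I\<close> and columns \<open>J\<close>, both in increasing order.\<close>

definition generic_minor :: "nat set \<Rightarrow> nat set \<Rightarrow> (nat \<times> nat, 'k::comm_ring_1) mpolynomial" where
  "generic_minor I J = det (mat (card I) (card J)
     (\<lambda>(a, b). mvar (sorted_list_of_set I ! a, sorted_list_of_set J ! b)))"

text \<open>The \<open>t\<close>-minors all of whose entries lie in \<open>T\<close>, and the ideal of \<open>k[Z\<^sub>T]\<close> they generate.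
  For \<open>T = [m] \<times> [n]\<close> these are all the \<open>t\<close>-minors of \<open>Z\<close> and the ideal \<open>I\<^sub>t(Z)\<close>.\<close>

definition minors_in :: "nat \<Rightarrow> (nat \<times> nat) set \<Rightarrow> (nat \<times> nat, 'k::comm_ring_1) mpolynomial set" where
  "minors_in t T = {generic_minor I J | I J.
     finite I \<and> finite J \<and> card I = t \<and> card J = t \<and> I \<times> J \<subseteq> T}"

definition det_ideal :: "nat \<Rightarrow> (nat \<times> nat) set \<Rightarrow> (nat \<times> nat, 'k::comm_ring_1) mpolynomial set" where
  "det_ideal t T = Idl\<^bsub>poly_ring_on T\<^esub> (minors_in t T)"

definition det_matroid_ground :: "nat \<Rightarrow> nat \<Rightarrow> (nat \<times> nat) set" where
  "det_matroid_ground m n = {1..m} \<times> {1..n}"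

definition det_matroid_indep ::
    "'k::field itself \<Rightarrow> nat \<Rightarrow> nat \<Rightarrow> nat \<Rightarrow> (nat \<times> nat) set \<Rightarrow> bool" where
  "det_matroid_indep K r m n \<Omega> \<longleftrightarrow> \<Omega> \<subseteq> det_matroid_ground m n \<and>
     (det_ideal (r + 1) (det_matroid_ground m n) :: (nat \<times> nat, 'k) mpolynomial set)
       \<inter> carrier (poly_ring_on \<Omega>) = {0}"

definition det_matroid_dep ::
    "'k::field itself \<Rightarrow> nat \<Rightarrow> nat \<Rightarrow> nat \<Rightarrow> (nat \<times> nat) set \<Rightarrow> bool" where
  "det_matroid_dep K r m n \<Omega> \<longleftrightarrow>
     \<Omega> \<subseteq> det_matroid_ground m n \<and> \<not> det_matroid_indep K r m n \<Omega>"

lemma mvars_simps [simp]: "mvars 0 = {}" "mvars 1 = {}" "mvars (- p) = mvars p"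
  for p :: "('x, 'k::comm_ring_1) mpolynomial"
  by (auto simp: mvars_def in_keys_iff)

lemma mvars_mvar: "mvars (mvar x :: ('x, 'k::zero_neq_one) mpolynomial) = {x}"
  by (simp add: mvars_def mvar_def)

lemma mvars_add: "mvars (p + q) \<subseteq> mvars p \<union> mvars q"
  for p q :: "('x, 'k::comm_ring_1) mpolynomial"
  using Poly_Mapping.keys_add[of p q] by (force simp: mvars_def)

lemma mvars_mult: "mvars (p * q) \<subseteq> mvars p \<union> mvars q"
  for p q :: "('x, 'k::comm_ring_1) mpolynomial"
proof
  fix x assume "x \<in> mvars (p * q)"
  then obtain t where t: "t \<in> Poly_Mapping.keys (p * q)" and x: "x \<in> Poly_Mapping.keys t"
    by (auto simp: mvars_def)
  from t obtain a b where ab: "t = a + b" "a \<in> Poly_Mapping.keys p" "b \<in> Poly_Mapping.keys q"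
    using keys_mult[of p q] by blast
  have "x \<in> Poly_Mapping.keys a \<union> Poly_Mapping.keys b"
    using x Poly_Mapping.keys_add[of a b] ab(1) by blast
  then show "x \<in> mvars p \<union> mvars q"
    using ab by (auto simp: mvars_def)
qed

lemma cring_poly_ring_on: "cring (poly_ring_on V :: ('x, 'k::comm_ring_1) mpolynomial ring)"
proof (rule cringI)
  show "abelian_group (poly_ring_on V :: ('x, 'k) mpolynomial ring)"
  proof (rule abelian_groupI)
    fix x :: "('x, 'k) mpolynomial"
    assume "x \<in> carrier (poly_ring_on V)"
    then show "\<exists>y\<in>carrier (poly_ring_on V). y \<oplus>\<^bsub>poly_ring_on V\<^esub> x = \<zero>\<^bsub>poly_ring_on V\<^esub>"
      by (intro bexI[of _ "- x"]) (auto simp: poly_ring_on_def)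
  qed (use mvars_add in \<open>fastforce simp: poly_ring_on_def algebra_simps\<close>)+
  show "comm_monoid (poly_ring_on V :: ('x, 'k) mpolynomial ring)"
    by (rule comm_monoidI)
       (use mvars_mult in \<open>fastforce simp: poly_ring_on_def algebra_simps\<close>)+
qed (auto simp: poly_ring_on_def algebra_simps)

lemma generic_minor_in_carrier:
  assumes "finite I" "finite J" "card I = card J" "I \<times> J \<subseteq> T"
  shows "(generic_minor I J :: (nat \<times> nat, 'k::comm_ring_1) mpolynomial) \<in> carrier (poly_ring_on T)"
proof -
  have sum: "mvars (sum f A) \<subseteq> T" if "\<And>a. a \<in> A \<Longrightarrow> mvars (f a) \<subseteq> T" "finite A"
    for f :: "'b \<Rightarrow> (nat \<times> nat, 'k) mpolynomial" and A
    using that(2,1) by (induction A) (auto dest!: subsetD[OF mvars_add])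
  have prod: "mvars (prod f A) \<subseteq> T" if "\<And>a. a \<in> A \<Longrightarrow> mvars (f a) \<subseteq> T" "finite A"
    for f :: "'b \<Rightarrow> (nat \<times> nat, 'k) mpolynomial" and A
    using that(2,1) by (induction A) (auto dest!: subsetD[OF mvars_mult])
  have entry: "(sorted_list_of_set I ! a, sorted_list_of_set J ! b) \<in> T"
    if "a < card I" "b < card J" for a b
    using assms nth_mem[of a "sorted_list_of_set I"] nth_mem[of b "sorted_list_of_set J"] that
    by auto
  have "mvars (signof \<pi> * (\<Prod>i = 0..<card I. mat (card I) (card J)
      (\<lambda>(a, b). mvar (sorted_list_of_set I ! a, sorted_list_of_set J ! b)
         :: (nat \<times> nat, 'k) mpolynomial) $$ (i, \<pi> i))) \<subseteq> T"
    if "\<pi> permutes {0..<card I}" for \<pi>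
  proof -
    have lt: "\<pi> i < card J" if "i < card I" for i
      using permutes_in_image[OF \<open>\<pi> permutes _\<close>, of i] that assms(3) by simp
    have "mvars (\<Prod>i = 0..<card I. mat (card I) (card J)
        (\<lambda>(a, b). mvar (sorted_list_of_set I ! a, sorted_list_of_set J ! b)
           :: (nat \<times> nat, 'k) mpolynomial) $$ (i, \<pi> i)) \<subseteq> T"
      by (rule prod) (simp_all add: lt mvars_mvar entry)
    then show ?thesis
      by (simp add: sign_def)
  qed
  then show ?thesis
    using assms(3)
    by (auto simp: generic_minor_def det_def poly_ring_on_def finite_permutations
        dest!: subsetD[OF sum, rotated 2])
qed

end

theory Submission
  imports Defs "HOL-Library.Product_Lexorder"
begin

text \<open>
  The theorem reduces to finding one block \<open>I \<times> J\<close> with \<open>|I|, |J| > r\<close> that \<open>\<Omega>\<close> nearly fills,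
  \<open>|I \<times> J - \<Omega>| < (|I| - r) (|J| - r)\<close>: in (b) the family consisting of this block alone serves
  (\<open>s = 1\<close>, so the condition on intersections is void), and in (a) one takes \<open>T = I \<times> J\<close>, since
  the \<open>(r+1)\<close>-minors of a generic \<open>p \<times> q\<close> matrix generate an ideal of height at least
  \<open>(p - r) (q - r)\<close>.

  \<^bold>\<open>Height.\<close>  Let \<open>P\<close> be a prime containing these minors, and choose a largest minor
  \<open>\<delta> \<notin> P\<close>, of size \<open>t \<le> r\<close>, with rows \<open>A\<close> and columns \<open>B\<close>.  Start with the
  variables in the rows \<open>A\<close> or the columns \<open>B\<close>, and add the other \<open>(p - t) (q - t)\<close>
  variables one at a time.  For each set \<open>S\<close> of variables reached, contracting \<open>P\<close> to \<open>k[S]\<close> and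
  extending it back gives a prime ideal inside \<open>P\<close>.  These ideals increase strictly, because
  the minor on \<open>A \<union> {i}\<close> and \<open>B \<union> {j}\<close> lies in \<open>P\<close> and involves the new
  variable \<open>z\<^sub>i\<^sub>j\<close> with coefficient \<open>\<delta> \<notin> P\<close>.  This is \<open>prime_height_det_ideal_ge\<close>.

  \<^bold>\<open>Dense blocks.\<close>  Let \<open>\<Omega>\<close> be dependent.  For every product \<open>X = A B\<close> with inner dimension \<open>r\<close>,
  the tangent vectors \<open>A' B + A B'\<close>, restricted to \<open>\<Omega>\<close>, do not fill \<open>k\<^sup>\<Omega>\<close>; otherwise a
  nonzero polynomial in \<open>Z\<^sub>\<Omega>\<close> could not vanish on all such products.  By duality there is a
  nonzero matrix \<open>Y\<close> supported in \<open>\<Omega>\<close> with \<open>A\<^sup>T Y = 0\<close> and \<open>Y B\<^sup>T = 0\<close>.  This is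
  \<open>dependent_imp_normal_vectors_exist\<close>, and it is used for very special \<open>A\<close> and \<open>B\<close>.

  For \<open>r = 1\<close> take all entries of \<open>A\<close> and \<open>B\<close> equal to 1.  All row and column sums of \<open>Y\<close>
  vanish, so each nonzero row and column has at least two nonzero entries, and the block spanned by
  the support of \<open>Y\<close> is dense (\<open>dense_block_rank_1\<close>).

  For \<open>m = r + 2\<close> choose \<open>A\<close> so that a vector of the two-dimensional left kernel with two
  zero entries vanishes.  Only columns of \<open>\<Omega>\<close> with at most one gap can then support
  \<open>Y\<close>.  Let \<open>F\<close> be the set of full columns, \<open>G\<^sub>i\<close> the set of those with their only
  gap in row \<open>i\<close>, and \<open>G\<close> the union of the \<open>G\<^sub>i\<close>.  If \<open>|F| + |G\<^sub>i| > r\<close> or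
  \<open>2 |F| + |G| > 2 r\<close>, there is an evident dense block.  Otherwise the columns of \<open>B\<close> can be
  chosen among the unit vectors so that full columns of \<open>\<Omega>\<close> have unit vectors of their own while
  each remaining one is shared by at most two columns with gaps in different rows; then
  \<open>Y = 0\<close> (\<open>dense_block_corank_2\<close>).  The case \<open>m = r + 1\<close> follows by adding an empty
  row, and \<open>n \<le> r + 2\<close> reduces to \<open>m \<le> r + 2\<close> by transposition.
\<close>

section \<open>Substitution in polynomials\<close>

definition monom_value :: "('x \<Rightarrow> 'r::comm_ring_1) \<Rightarrow> ('x \<Rightarrow>\<^sub>0 nat) \<Rightarrow> 'r" where
  "monom_value f t = (\<Prod>x\<in>Poly_Mapping.keys t. f x ^ Poly_Mapping.lookup t x)"

definition subst ::
    "('k::comm_ring_1 \<Rightarrow> 'r::comm_ring_1) \<Rightarrow> ('x \<Rightarrow> 'r) \<Rightarrow> ('x, 'k) mpolynomial \<Rightarrow> 'r" where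
  "subst c f p = (\<Sum>t\<in>Poly_Mapping.keys p. c (Poly_Mapping.lookup p t) * monom_value f t)"

lemma monom_value_0 [simp]: "monom_value f 0 = 1"
  by (simp add: monom_value_def)

lemma monom_value_superset:
  assumes "finite X" "Poly_Mapping.keys t \<subseteq> X"
  shows "monom_value f t = (\<Prod>x\<in>X. f x ^ Poly_Mapping.lookup t x)"
  unfolding monom_value_def
  by (rule prod.mono_neutral_left) (use assms in \<open>auto simp: in_keys_iff\<close>)

lemma monom_value_add: "monom_value f (s + t) = monom_value f s * monom_value f t"
proof -
  let ?X = "Poly_Mapping.keys s \<union> Poly_Mapping.keys t"
  have "monom_value f (s + t) = (\<Prod>x\<in>?X. f x ^ Poly_Mapping.lookup (s + t) x)"
    by (rule monom_value_superset) (use Poly_Mapping.keys_add[of s t] in auto)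
  also have "\<dots> = monom_value f s * monom_value f t"
    by (simp add: monom_value_superset[of ?X] lookup_add power_add prod.distrib)
  finally show ?thesis .
qed

lemma monom_value_single: "monom_value f (Poly_Mapping.single x e) = f x ^ e"
  by (simp add: monom_value_def)

lemma poly_mapping_sum_single: "p = (\<Sum>t\<in>Poly_Mapping.keys p. Poly_Mapping.single t (Poly_Mapping.lookup p t))"
  by (rule poly_mapping_eqI)
     (simp add: lookup_sum lookup_single when_def sum.delta in_keys_iff)

context comm_ring_hom
begin

lemma subst_superset:
  assumes "finite T" "Poly_Mapping.keys p \<subseteq> T"
  shows "subst hom f p = (\<Sum>t\<in>T. hom (Poly_Mapping.lookup p t) * monom_value f t)"
  unfolding subst_def
  by (rule sum.mono_neutral_left) (use assms in \<open>auto simp: in_keys_iff\<close>)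

lemma subst_single: "subst hom f (Poly_Mapping.single t a) = hom a * monom_value f t"
  by (subst subst_superset[of "{t}"]) auto

lemma subst_mvar: "subst hom f (mvar x) = f x"
  by (simp add: mvar_def subst_single monom_value_single)

lemma subst_0: "subst hom f 0 = 0"
  by (simp add: subst_def)

lemma subst_add: "subst hom f (p + q) = subst hom f p + subst hom f q"
proof -
  let ?T = "Poly_Mapping.keys p \<union> Poly_Mapping.keys q"
  have "subst hom f (p + q) = (\<Sum>t\<in>?T. hom (Poly_Mapping.lookup (p + q) t) * monom_value f t)"
    by (rule subst_superset) (use Poly_Mapping.keys_add[of p q] in auto)
  then show ?thesis
    by (simp add: subst_superset[of ?T] lookup_add hom_add distrib_right sum.distrib)
qed

lemma subst_sum: "subst hom f (sum p A) = (\<Sum>a\<in>A. subst hom f (p a))"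
  by (induction A rule: infinite_finite_induct) (auto simp: subst_0 subst_add)

lemma subst_mult: "subst hom f (p * q) = subst hom f p * subst hom f q"
proof -
  have "p * q = (\<Sum>s\<in>Poly_Mapping.keys p. Poly_Mapping.single s (Poly_Mapping.lookup p s)) *
      (\<Sum>t\<in>Poly_Mapping.keys q. Poly_Mapping.single t (Poly_Mapping.lookup q t))"
    using poly_mapping_sum_single[of p] poly_mapping_sum_single[of q] by simp
  then have "p * q = (\<Sum>s\<in>Poly_Mapping.keys p. \<Sum>t\<in>Poly_Mapping.keys q.
      Poly_Mapping.single (s + t) (Poly_Mapping.lookup p s * Poly_Mapping.lookup q t))"
    by (simp add: sum_product mult_single)
  then show ?thesis
    by (simp add: subst_sum subst_single monom_value_add hom_mult)
       (simp add: subst_def sum_product ac_simps)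
qed

lemma subst_1: "subst hom f 1 = 1"
  by (simp add: subst_single flip: single_one)

lemma comm_ring_hom_subst: "comm_ring_hom (subst hom f)"
  by unfold_locales (simp_all add: subst_0 subst_add subst_mult subst_1)

end

lemma comm_ring_hom_comp_subst:
  assumes "comm_ring_hom h"
  shows "h (subst c f p) = subst (h \<circ> c) (h \<circ> f) p"
proof -
  interpret comm_ring_hom h by fact
  show ?thesis
    by (simp add: subst_def monom_value_def hom_sum hom_mult hom_prod hom_power)
qed

lemma comm_ring_hom_single_0: "comm_ring_hom (Poly_Mapping.single (0::'x \<Rightarrow>\<^sub>0 nat) :: 'k::comm_ring_1 \<Rightarrow> _)"
  by unfold_locales (simp_all add: single_add mult_single)

lemma monom_value_mvar:
  "monom_value mvar t = (Poly_Mapping.single t 1 :: ('x, 'k::comm_ring_1) mpolynomial)"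
proof -
  have pow: "mvar x ^ e = (Poly_Mapping.single (Poly_Mapping.single x e) 1 :: ('x, 'k) mpolynomial)" for x e
    by (induction e) (simp_all add: mvar_def mult_single flip: single_add)
  have prod: "(\<Prod>x\<in>X. mvar x ^ (g x)) =
      (Poly_Mapping.single (\<Sum>x\<in>X. Poly_Mapping.single x (g x)) 1 :: ('x, 'k) mpolynomial)"
    if "finite X" for X and g :: "'x \<Rightarrow> nat"
    using that by (induction X rule: finite_induct) (simp_all add: pow mult_single)
  show ?thesis
    unfolding monom_value_def by (simp add: prod flip: poly_mapping_sum_single)
qed

lemma subst_mvar_id: "subst (Poly_Mapping.single 0) mvar p = (p :: ('x, 'k::comm_ring_1) mpolynomial)"
  unfolding subst_def by (simp add: monom_value_mvar mult_single flip: poly_mapping_sum_single)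

lemma subst_cong:
  assumes "\<And>x. x \<in> mvars p \<Longrightarrow> f x = g x"
  shows "subst c f p = subst c g p"
  unfolding subst_def monom_value_def
  by (intro sum.cong prod.cong arg_cong2[where f = "(*)"] refl arg_cong2[where f = "(^)"] assms)
     (auto simp: mvars_def)

lemma comm_ring_hom_id: "comm_ring_hom id"
  by unfold_locales simp_all

text \<open>A form of the convolution formula with finite index sets, so that closure properties of ideals
  apply to each summand.\<close>

lemma lookup_mult_sum:
  "Poly_Mapping.lookup (F * G) u = (\<Sum>(s, t)\<in>Poly_Mapping.keys F \<times> Poly_Mapping.keys G.
     if s + t = u then Poly_Mapping.lookup F s * Poly_Mapping.lookup G t else 0)"
proof -
  have "F * G = (\<Sum>s\<in>Poly_Mapping.keys F. Poly_Mapping.single s (Poly_Mapping.lookup F s)) *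
      (\<Sum>t\<in>Poly_Mapping.keys G. Poly_Mapping.single t (Poly_Mapping.lookup G t))"
    using poly_mapping_sum_single[of F] poly_mapping_sum_single[of G] by simp
  then have "F * G = (\<Sum>(s, t)\<in>Poly_Mapping.keys F \<times> Poly_Mapping.keys G.
      Poly_Mapping.single (s + t) (Poly_Mapping.lookup F s * Poly_Mapping.lookup G t))"
    by (simp add: sum_product mult_single sum.cartesian_product)
  then show ?thesis
    by (simp add: lookup_sum lookup_single when_def case_prod_unfold)
qed

lemma mvars_add_subset: "mvars p \<subseteq> W \<Longrightarrow> mvars q \<subseteq> W \<Longrightarrow> mvars (p + q) \<subseteq> W"
  for p q :: "('x, 'k::comm_ring_1) mpolynomial"
  by (rule order_trans[OF mvars_add Un_least])

lemma mvars_mult_subset: "mvars p \<subseteq> W \<Longrightarrow> mvars q \<subseteq> W \<Longrightarrow> mvars (p * q) \<subseteq> W"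
  for p q :: "('x, 'k::comm_ring_1) mpolynomial"
  by (rule order_trans[OF mvars_mult Un_least])

lemma mvars_sum_subset:
  fixes f :: "'a \<Rightarrow> ('x, 'k::comm_ring_1) mpolynomial"
  assumes "\<And>a. a \<in> A \<Longrightarrow> mvars (f a) \<subseteq> W"
  shows "mvars (sum f A) \<subseteq> W"
  using assms by (induction A rule: infinite_finite_induct) (simp_all add: mvars_add_subset)

lemma mvars_prod_subset:
  fixes f :: "'a \<Rightarrow> ('x, 'k::comm_ring_1) mpolynomial"
  assumes "\<And>a. a \<in> A \<Longrightarrow> mvars (f a) \<subseteq> W"
  shows "mvars (prod f A) \<subseteq> W"
  using assms by (induction A rule: infinite_finite_induct) (simp_all add: mvars_mult_subset)

lemma mvars_power_subset: "mvars p \<subseteq> W \<Longrightarrow> mvars (p ^ e) \<subseteq> W"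
  for p :: "('x, 'k::comm_ring_1) mpolynomial"
  by (induction e) (simp_all add: mvars_mult_subset)

lemma mvars_monom_value_subset:
  assumes "\<And>x. x \<in> Poly_Mapping.keys t \<Longrightarrow> mvars (f x) \<subseteq> W"
  shows "mvars (monom_value f t :: ('x, 'k::comm_ring_1) mpolynomial) \<subseteq> W"
  unfolding monom_value_def
  by (rule mvars_prod_subset, rule mvars_power_subset, rule assms)

lemma carrier_poly_ring_on: "carrier (poly_ring_on V) = {p. mvars p \<subseteq> V}"
  by (simp add: poly_ring_on_def)

lemma poly_ring_on_simps:
  "monoid.mult (poly_ring_on V) = (*)" "monoid.one (poly_ring_on V) = 1"
  "ring.zero (poly_ring_on V) = 0" "add (poly_ring_on V) = (+)"
  by (simp_all add: poly_ring_on_def)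

lemma ideal_poly_ring_onI:
  fixes Q :: "('x, 'k::comm_ring_1) mpolynomial set"
  assumes "Q \<subseteq> {p. mvars p \<subseteq> V}" and "0 \<in> Q"
    and add: "\<And>p q. p \<in> Q \<Longrightarrow> q \<in> Q \<Longrightarrow> p + q \<in> Q"
    and mult: "\<And>a p. mvars a \<subseteq> V \<Longrightarrow> p \<in> Q \<Longrightarrow> a * p \<in> Q"
  shows "ideal Q (poly_ring_on V)"
proof (rule idealI)
  have R: "cring (poly_ring_on V :: ('x, 'k) mpolynomial ring)" by (rule cring_poly_ring_on)
  then show "ring (poly_ring_on V :: ('x, 'k) mpolynomial ring)" by (rule cring.axioms(1))
  interpret R: cring "poly_ring_on V :: ('x, 'k) mpolynomial ring" by (rule R)
  show "subgroup Q (add_monoid (poly_ring_on V))"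
  proof (rule R.add.subgroupI)
    fix p assume p: "p \<in> Q"
    then have "mvars p \<subseteq> V" using assms(1) by auto
    then have "\<ominus>\<^bsub>poly_ring_on V\<^esub> p = - p"
      by (intro R.minus_equality) (simp_all add: poly_ring_on_def)
    moreover have "- p \<in> Q" using mult[of "- 1" p] p by simp
    ultimately show "\<ominus>\<^bsub>poly_ring_on V\<^esub> p \<in> Q" by simp
  qed (use assms in \<open>auto simp: poly_ring_on_simps carrier_poly_ring_on\<close>)
  fix a p :: "('x, 'k) mpolynomial"
  assume "p \<in> Q" "a \<in> carrier (poly_ring_on V)"
  then show "a \<otimes>\<^bsub>poly_ring_on V\<^esub> p \<in> Q" and "p \<otimes>\<^bsub>poly_ring_on V\<^esub> a \<in> Q"
    by (simp_all add: poly_ring_on_simps carrier_poly_ring_on mult mult.commute[of p a])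
qed

section \<open>Extending contractions of prime ideals\<close>

text \<open>\<open>k[X]\<close> viewed as \<open>k[S][X - S]\<close>: the outer monomials involve the variables outside
  \<open>S\<close>, and the coefficients are polynomials in the variables of \<open>S\<close>.\<close>

definition split_poly :: "'x set \<Rightarrow> ('x, 'k::comm_ring_1) mpolynomial \<Rightarrow> ('x, ('x, 'k) mpolynomial) mpolynomial" where
  "split_poly S = subst (\<lambda>a. Poly_Mapping.single 0 (Poly_Mapping.single 0 a))
     (\<lambda>x. if x \<in> S then Poly_Mapping.single 0 (mvar x) else mvar x)"

lemma comm_ring_hom_single_single:
  "comm_ring_hom (\<lambda>a::'k::comm_ring_1. Poly_Mapping.single (0::'x \<Rightarrow>\<^sub>0 nat) (Poly_Mapping.single (0::'y \<Rightarrow>\<^sub>0 nat) a))"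
  by unfold_locales (simp_all add: single_add mult_single)

lemma comm_ring_hom_split_poly: "comm_ring_hom (split_poly S)"
  unfolding split_poly_def
  by (rule comm_ring_hom.comm_ring_hom_subst[OF comm_ring_hom_single_single])

lemma split_poly_const:
  assumes "mvars p \<subseteq> S"
  shows "split_poly S p = Poly_Mapping.single 0 p"
proof -
  have "split_poly S p = subst (Poly_Mapping.single 0 \<circ> Poly_Mapping.single 0)
      (Poly_Mapping.single 0 \<circ> mvar) p"
    unfolding split_poly_def comp_def by (rule subst_cong) (use assms in auto)
  also have "\<dots> = Poly_Mapping.single 0 (subst (Poly_Mapping.single 0) mvar p)"
    by (rule comm_ring_hom_comp_subst[symmetric, OF comm_ring_hom_single_0])
  finally show ?thesis
    by (simp add: subst_mvar_id)
qed

lemma split_poly_mvar: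
  "split_poly S (mvar x) = (if x \<in> S then Poly_Mapping.single 0 (mvar x) else mvar x)"
  unfolding split_poly_def by (rule comm_ring_hom.subst_mvar[OF comm_ring_hom_single_single])

lemma split_poly_reconstruct:
  "p = (\<Sum>t\<in>Poly_Mapping.keys (split_poly S p). Poly_Mapping.lookup (split_poly S p) t * monom_value mvar t)"
proof -
  have "subst id mvar (split_poly S p) = subst (Poly_Mapping.single 0) mvar p"
    unfolding split_poly_def
    by (subst comm_ring_hom_comp_subst[OF comm_ring_hom.comm_ring_hom_subst[OF comm_ring_hom_id]])
       (simp add: comp_def comm_ring_hom.subst_single[OF comm_ring_hom_id]
          comm_ring_hom.subst_mvar[OF comm_ring_hom_id] if_distrib cong: if_cong)
  then show ?thesis unfolding subst_mvar_id by (simp add: subst_def)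
qed

text \<open>\<open>k[W][V]\<close> inside the polynomials whose coefficients are polynomials.\<close>

definition polys_over :: "'y set \<Rightarrow> 'x set \<Rightarrow> ('y, ('x, 'k::comm_ring_1) mpolynomial) mpolynomial set" where
  "polys_over V W = {F. mvars F \<subseteq> V \<and> (\<forall>t. mvars (Poly_Mapping.lookup F t) \<subseteq> W)}"

lemma polys_over_single_0: "mvars p \<subseteq> W \<Longrightarrow> Poly_Mapping.single 0 p \<in> polys_over V W"
  by (auto simp: polys_over_def mvars_def lookup_single when_def split: if_splits)

lemma polys_over_mvar: "x \<in> V \<Longrightarrow> mvar x \<in> polys_over V W"
  by (auto simp: polys_over_def mvars_mvar) (auto simp: mvar_def lookup_single when_def split: if_splits)

lemma polys_over_add:
  assumes "F \<in> polys_over V W" "G \<in> polys_over V W"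
  shows "F + G \<in> polys_over V W"
  using assms by (simp add: polys_over_def lookup_add mvars_add_subset)

lemma polys_over_mult:
  assumes "F \<in> polys_over V W" "G \<in> polys_over V W"
  shows "F * G \<in> polys_over V W"
proof -
  have "mvars (Poly_Mapping.lookup (F * G) u) \<subseteq> W" for u
    unfolding lookup_mult_sum
    by (rule mvars_sum_subset)
       (use assms in \<open>simp add: polys_over_def mvars_mult_subset split: prod.splits\<close>)
  then show ?thesis
    using assms by (simp add: polys_over_def mvars_mult_subset)
qed

lemma polys_over_1: "1 \<in> polys_over V W"
  using polys_over_single_0[of 1 W V] by simp

lemma polys_over_0: "0 \<in> polys_over V W"
  using polys_over_single_0[of 0 W V] by simp

lemma polys_over_sum:
  assumes "\<And>a. a \<in> A \<Longrightarrow> f a \<in> polys_over V W"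
  shows "sum f A \<in> polys_over V W"
  using assms by (induction A rule: infinite_finite_induct) (simp_all add: polys_over_0 polys_over_add)

lemma polys_over_prod:
  assumes "\<And>a. a \<in> A \<Longrightarrow> f a \<in> polys_over V W"
  shows "prod f A \<in> polys_over V W"
  using assms by (induction A rule: infinite_finite_induct) (simp_all add: polys_over_1 polys_over_mult)

lemma polys_over_power:
  assumes "F \<in> polys_over V W"
  shows "F ^ e \<in> polys_over V W"
  using assms by (induction e) (simp_all add: polys_over_1 polys_over_mult)

lemma split_poly_in_polys_over:
  fixes p :: "('x, 'k::comm_ring_1) mpolynomial"
  assumes "mvars p \<subseteq> V"
  shows "split_poly S p \<in> polys_over (V - S) (V \<inter> S)"
proof -
  have const: "Poly_Mapping.single 0 (Poly_Mapping.single 0 a) \<in> polys_over (V - S) (V \<inter> S)" for a :: 'k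
    by (rule polys_over_single_0) (simp add: mvars_def)
  have var: "(if x \<in> S then Poly_Mapping.single 0 (mvar x) else mvar x :: ('x, ('x, 'k) mpolynomial) mpolynomial)
      \<in> polys_over (V - S) (V \<inter> S)" if "x \<in> V" for x
    using that by (simp add: polys_over_single_0 polys_over_mvar mvars_mvar)
  have V: "x \<in> V" if "x \<in> Poly_Mapping.keys t" "t \<in> Poly_Mapping.keys p" for x t
    using assms that by (auto simp: mvars_def)
  show ?thesis
    unfolding split_poly_def subst_def monom_value_def
    by (intro polys_over_sum polys_over_mult polys_over_prod polys_over_power const var V)
qed

text \<open>The ideal \<open>(P \<inter> k[S]) k[V]\<close>, described by coefficients: a polynomial belongs to it if and
  only if its coefficients over \<open>k[S]\<close> lie in \<open>P\<close>.\<close>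

definition extended_contraction ::
    "'x set \<Rightarrow> 'x set \<Rightarrow> ('x, 'k::comm_ring_1) mpolynomial set \<Rightarrow> ('x, 'k) mpolynomial set" where
  "extended_contraction V S P = {p. mvars p \<subseteq> V \<and> (\<forall>t. Poly_Mapping.lookup (split_poly S p) t \<in> P)}"

locale prime_of_poly_ring_on =
  fixes V :: "'x::linorder set" and P :: "('x, 'k::comm_ring_1) mpolynomial set"
  assumes prime: "primeideal P (poly_ring_on V)"
begin

sublocale P: primeideal P "poly_ring_on V :: ('x, 'k) mpolynomial ring"
  by (rule prime)

lemma mvars_subset: "p \<in> P \<Longrightarrow> mvars p \<subseteq> V"
  using P.a_subset by (auto simp: carrier_poly_ring_on)

lemma zero_mem: "0 \<in> P"
  using P.additive_subgroup_axioms additive_subgroup.zero_closed by (fastforce simp: poly_ring_on_simps)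

lemma add_mem: "p \<in> P \<Longrightarrow> q \<in> P \<Longrightarrow> p + q \<in> P"
  using additive_subgroup.a_closed[OF P.additive_subgroup_axioms, of p q] by (simp add: poly_ring_on_simps)

lemma mult_mem: "mvars a \<subseteq> V \<Longrightarrow> p \<in> P \<Longrightarrow> a * p \<in> P"
  using P.I_l_closed[of p a] by (simp add: poly_ring_on_simps carrier_poly_ring_on)

lemma sum_mem: "(\<And>a. a \<in> A \<Longrightarrow> f a \<in> P) \<Longrightarrow> sum f A \<in> P"
  by (induction A rule: infinite_finite_induct) (simp_all add: zero_mem add_mem)

lemma diff_mem: "p \<in> P \<Longrightarrow> q \<in> P \<Longrightarrow> p - q \<in> P"
  using add_mem[of p "- q"] mult_mem[of "- 1" q] by simp

lemma prime_mem: "mvars p \<subseteq> V \<Longrightarrow> mvars q \<subseteq> V \<Longrightarrow> p * q \<in> P \<Longrightarrow> p \<in> P \<or> q \<in> P"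
  using P.I_prime[of p q] by (simp add: poly_ring_on_simps carrier_poly_ring_on)

lemma one_not_mem: "1 \<notin> P"
  using P.one_imp_carrier P.I_notcarr by (auto simp: poly_ring_on_simps)

lemma coeffs_mult_mem:
  assumes F: "\<And>t. mvars (Poly_Mapping.lookup F t) \<subseteq> V" and G: "\<And>t. Poly_Mapping.lookup G t \<in> P"
  shows "Poly_Mapping.lookup (F * G) t \<in> P"
  unfolding lookup_mult_sum by (rule sum_mem) (auto simp: mult_mem[OF F G] zero_mem)

text \<open>Gauss's lemma, by comparing coefficients at the sum of the largest exponents.\<close>

lemma coeffs_prime:
  fixes F G :: "('x, ('x, 'k) mpolynomial) mpolynomial"
  assumes F: "\<And>t. mvars (Poly_Mapping.lookup F t) \<subseteq> V" and G: "\<And>t. mvars (Poly_Mapping.lookup G t) \<subseteq> V"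
    and FG: "\<And>t. Poly_Mapping.lookup (F * G) t \<in> P"
  shows "(\<forall>t. Poly_Mapping.lookup F t \<in> P) \<or> (\<forall>t. Poly_Mapping.lookup G t \<in> P)"
proof (rule ccontr)
  assume contra: "\<not> ?thesis"
  define A where "A = {t. Poly_Mapping.lookup F t \<notin> P}"
  define B where "B = {t. Poly_Mapping.lookup G t \<notin> P}"
  have AF: "A \<subseteq> Poly_Mapping.keys F" and BG: "B \<subseteq> Poly_Mapping.keys G"
    using zero_mem by (auto simp: A_def B_def in_keys_iff)
  have fin: "finite A" "finite B"
    using AF BG finite_subset[OF _ finite_keys] by blast+
  have ne: "A \<noteq> {}" "B \<noteq> {}"
    using contra by (auto simp: A_def B_def)
  define a where "a = Max A"
  define b where "b = Max B"
  have a: "a \<in> A" and b: "b \<in> B"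
    using fin ne by (simp_all add: a_def b_def)
  let ?K = "Poly_Mapping.keys F \<times> Poly_Mapping.keys G"
  \<comment> \<open>The product of the coefficients at the largest exponents \<open>a\<close> and \<open>b\<close> outside \<open>P\<close> is the only
    term of the coefficient at \<open>a + b\<close> that could lie outside \<open>P\<close>.\<close>
  let ?h = "\<lambda>(s, t). if s + t = a + b then Poly_Mapping.lookup F s * Poly_Mapping.lookup G t else 0"
  have "Poly_Mapping.lookup (F * G) (a + b) = sum ?h ?K"
    by (rule lookup_mult_sum)
  also have "\<dots> = ?h (a, b) + sum ?h (?K - {(a, b)})"
    by (rule sum.remove) (use a b AF BG in auto)
  finally have eq: "Poly_Mapping.lookup F a * Poly_Mapping.lookup G b =
      Poly_Mapping.lookup (F * G) (a + b) - sum ?h (?K - {(a, b)})"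
    by simp
  have "sum ?h (?K - {(a, b)}) \<in> P"
  proof (rule sum_mem)
    fix st assume st_mem: "st \<in> ?K - {(a, b)}"
    obtain s t where st: "st = (s, t)" by force
    show "?h st \<in> P"
    proof (cases "s + t = a + b")
      case True
      have "s \<notin> A \<or> t \<notin> B"
      proof (rule ccontr)
        assume "\<not> ?thesis"
        then have le: "s \<le> a" "t \<le> b" using fin by (auto simp: a_def b_def)
        then have "s = a \<and> t = b"
          using True add_less_le_mono[of s a t b] add_le_less_mono[of s a t b] by fastforce
        then show False using st_mem st by simp
      qed
      then have "Poly_Mapping.lookup F s * Poly_Mapping.lookup G t \<in> P"
        using mult_mem[OF F, of "Poly_Mapping.lookup G t" s] mult_mem[OF G, of "Poly_Mapping.lookup F s" t]
        by (auto simp: A_def B_def mult.commute)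
      then show ?thesis using st True by simp
    qed (simp add: st zero_mem)
  qed
  then have "Poly_Mapping.lookup F a * Poly_Mapping.lookup G b \<in> P"
    unfolding eq by (intro diff_mem FG)
  then show False
    using prime_mem[OF F G] a b by (auto simp: A_def B_def)
qed

lemma mvars_coeff_split_poly:
  assumes "mvars p \<subseteq> V"
  shows "mvars (Poly_Mapping.lookup (split_poly S p) t) \<subseteq> V \<inter> S"
  using split_poly_in_polys_over[OF assms, of S] unfolding polys_over_def by blast

lemma mvars_coeff_split_poly': "mvars p \<subseteq> V \<Longrightarrow> mvars (Poly_Mapping.lookup (split_poly S p) t) \<subseteq> V"
  using mvars_coeff_split_poly by blast

text \<open>The quotient of \<open>k[V]\<close> by this ideal is a polynomial ring over the domain
  \<open>k[S] / (P \<inter> k[S])\<close>; with coefficients instead of quotients, this is Gauss's lemma.\<close>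

lemma prime_extended_contraction: "primeideal (extended_contraction V S P) (poly_ring_on V)"
proof (rule primeidealI)
  interpret split: comm_ring_hom "split_poly S :: ('x, 'k) mpolynomial \<Rightarrow> _"
    by (rule comm_ring_hom_split_poly)
  show "ideal (extended_contraction V S P) (poly_ring_on V)"
  proof (rule ideal_poly_ring_onI)
    fix a p :: "('x, 'k) mpolynomial"
    assume a: "mvars a \<subseteq> V" and p: "p \<in> extended_contraction V S P"
    then show "a * p \<in> extended_contraction V S P"
      by (simp add: extended_contraction_def split.hom_mult coeffs_mult_mem mvars_coeff_split_poly'
          mvars_mult_subset)
  qed (auto simp: extended_contraction_def split.hom_add lookup_add zero_mem add_mem mvars_add_subset)
  show "cring (poly_ring_on V :: ('x, 'k) mpolynomial ring)" by (rule cring_poly_ring_on)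
  have "1 \<notin> extended_contraction V S P"
    using one_not_mem lookup_one_zero
    by (auto simp: extended_contraction_def split.hom_one intro!: exI[of _ 0])
  then show "carrier (poly_ring_on V) \<noteq> extended_contraction V S P"
    by (auto simp: carrier_poly_ring_on)
  fix p q :: "('x, 'k) mpolynomial"
  assume "p \<in> carrier (poly_ring_on V)" "q \<in> carrier (poly_ring_on V)"
    and "p \<otimes>\<^bsub>poly_ring_on V\<^esub> q \<in> extended_contraction V S P"
  then show "p \<in> extended_contraction V S P \<or> q \<in> extended_contraction V S P"
    using coeffs_prime[of "split_poly S p" "split_poly S q"]
    by (simp add: carrier_poly_ring_on poly_ring_on_simps extended_contraction_def split.hom_mult
        mvars_coeff_split_poly')
qed

text \<open>A coefficient over \<open>k[S']\<close> of a polynomial is a combination of its coefficients over the smaller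
  ring \<open>k[S]\<close>, which are constants for the splitting along \<open>S'\<close>.\<close>

lemma extended_contraction_mono:
  assumes "S \<subseteq> S'"
  shows "extended_contraction V S P \<subseteq> extended_contraction V S' P"
proof
  interpret split: comm_ring_hom "split_poly S' :: ('x, 'k) mpolynomial \<Rightarrow> _"
    by (rule comm_ring_hom_split_poly)
  fix p assume p: "p \<in> extended_contraction V S P"
  then have pV: "mvars p \<subseteq> V" by (simp add: extended_contraction_def)
  let ?F = "split_poly S p"
  have F: "mvars ?F \<subseteq> V - S"
    using split_poly_in_polys_over[OF pV, of S] by (simp add: polys_over_def)
  have const: "split_poly S' (Poly_Mapping.lookup ?F t) = Poly_Mapping.single 0 (Poly_Mapping.lookup ?F t)" for t
    using mvars_coeff_split_poly[OF pV, of S t] assms by (intro split_poly_const) blast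
  have "split_poly S' p = (\<Sum>t\<in>Poly_Mapping.keys ?F.
      split_poly S' (monom_value mvar t) * Poly_Mapping.single 0 (Poly_Mapping.lookup ?F t))"
    by (subst split_poly_reconstruct[of p S]) (simp add: split.hom_sum split.hom_mult const mult.commute)
  moreover have "Poly_Mapping.lookup (split_poly S' (monom_value mvar t) *
      Poly_Mapping.single 0 (Poly_Mapping.lookup ?F t)) u \<in> P" if "t \<in> Poly_Mapping.keys ?F" for t u
  proof (rule coeffs_mult_mem)
    have "mvars (monom_value mvar t :: ('x, 'k) mpolynomial) \<subseteq> V"
      by (rule mvars_monom_value_subset) (use F that in \<open>auto simp: mvars_mvar mvars_def[of ?F]\<close>)
    then show "mvars (Poly_Mapping.lookup (split_poly S' (monom_value mvar t)) v :: ('x, 'k) mpolynomial) \<subseteq> V" for v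
      by (rule mvars_coeff_split_poly')
    show "Poly_Mapping.lookup (Poly_Mapping.single 0 (Poly_Mapping.lookup ?F t)) v \<in> P" for v
      using p by (simp add: lookup_single when_def zero_mem extended_contraction_def)
  qed
  ultimately show "p \<in> extended_contraction V S' P"
    using pV by (auto simp: extended_contraction_def lookup_sum intro!: sum_mem)
qed

lemma mem_extended_contraction:
  assumes "p \<in> P" "mvars p \<subseteq> S"
  shows "p \<in> extended_contraction V S P"
  using assms mvars_subset[OF assms(1)]
  by (simp add: extended_contraction_def split_poly_const lookup_single when_def zero_mem)

lemma extended_contraction_self: "extended_contraction V V P = P"
proof
  show "extended_contraction V V P \<subseteq> P"
  proof
    fix p assume "p \<in> extended_contraction V V P"
    then have "mvars p \<subseteq> V" "Poly_Mapping.lookup (split_poly V p) 0 \<in> P"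
      by (auto simp: extended_contraction_def)
    then show "p \<in> P" by (simp add: split_poly_const)
  qed
qed (use mem_extended_contraction mvars_subset in blast)

text \<open>Along a growing chain of variable sets, the extended contractions of \<open>P\<close> increase strictly
  wherever \<open>P\<close> has an element \<open>f\<close> in the new variables with some coefficient over the
  old ones outside \<open>P\<close>.\<close>

lemma prime_height_ge:
  assumes "\<And>i. i < N \<Longrightarrow> S i \<subseteq> S (Suc i)" and "S N = V"
    and "\<And>i. i < N \<Longrightarrow> f i \<in> P" and "\<And>i. i < N \<Longrightarrow> mvars (f i) \<subseteq> S (Suc i)"
    and "\<And>i. i < N \<Longrightarrow> Poly_Mapping.lookup (split_poly (S i) (f i)) (t i) \<notin> P"
  shows "enat N \<le> prime_height (poly_ring_on V) P"
proof -
  define C where "C i = extended_contraction V (S i) P" for i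
  have "primeideal (C i) (poly_ring_on V)" for i
    unfolding C_def by (rule prime_extended_contraction)
  moreover have "C N = P"
    by (simp add: C_def assms(2) extended_contraction_self)
  moreover have "C i \<subset> C (Suc i)" if i: "i < N" for i
  proof
    show "C i \<subseteq> C (Suc i)"
      unfolding C_def by (rule extended_contraction_mono[OF assms(1)[OF i]])
    have "f i \<in> C (Suc i)"
      unfolding C_def by (rule mem_extended_contraction[OF assms(3,4)[OF i]])
    moreover have "f i \<notin> C i"
      using assms(5)[OF i] by (auto simp: C_def extended_contraction_def)
    ultimately show "C i \<noteq> C (Suc i)" by blast
  qed
  ultimately show ?thesis
    unfolding prime_height_def by (intro Sup_upper) blast
qed

end

section \<open>A lower bound for the height of a determinantal ideal\<close>

text \<open>Minors with rows and columns in an arbitrary order.  This allows a new row and column to be placed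
  last, where the cofactor of the corner entry is the old minor itself and not its negative.\<close>

definition list_minor :: "'a list \<Rightarrow> 'b list \<Rightarrow> ('a \<times> 'b, 'k::comm_ring_1) mpolynomial" where
  "list_minor xs ys = det (mat (length xs) (length xs) (\<lambda>(a, b). mvar (xs ! a, ys ! b)))"

lemma generic_minor_eq_list_minor:
  assumes "card I = card J"
  shows "generic_minor I J = list_minor (sorted_list_of_set I) (sorted_list_of_set J)"
  by (simp add: generic_minor_def list_minor_def assms)

lemma det_permute_row_list:
  fixes g :: "'a \<Rightarrow> nat \<Rightarrow> 'r::comm_ring_1"
  assumes "mset xs = mset xs'"
  shows "\<exists>c\<in>{1, -1}. det (mat (length xs) (length xs) (\<lambda>(a, b). g (xs ! a) b)) =
    c * det (mat (length xs') (length xs') (\<lambda>(a, b). g (xs' ! a) b))"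
proof -
  let ?n = "length xs'"
  have len: "length xs = ?n" using assms by (rule mset_eq_length)
  obtain p where p: "p permutes {..<?n}" and xs: "permute_list p xs' = xs"
    using mset_eq_permutation[OF assms] by blast
  let ?A = "mat ?n ?n (\<lambda>(a, b). g (xs' ! a) b)"
  have p': "p permutes {0..<?n}" using p by (simp add: atLeast0LessThan)
  have "mat (length xs) (length xs) (\<lambda>(a, b). g (xs ! a) b) = mat ?n ?n (\<lambda>(a, b). ?A $$ (p a, b))"
  proof (rule eq_matI)
    fix a b assume ab: "a < dim_row (mat ?n ?n (\<lambda>(a, b). ?A $$ (p a, b)))"
      "b < dim_col (mat ?n ?n (\<lambda>(a, b). ?A $$ (p a, b)))"
    then have "p a < ?n" using permutes_in_image[OF p, of a] by simp
    moreover have "xs ! a = xs' ! p a" using ab by (subst xs[symmetric]) (simp add: permute_list_nth[OF p])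
    ultimately show "mat (length xs) (length xs) (\<lambda>(a, b). g (xs ! a) b) $$ (a, b) =
        mat ?n ?n (\<lambda>(a, b). ?A $$ (p a, b)) $$ (a, b)"
      using ab len by simp
  qed (simp_all add: len)
  also have "det \<dots> = signof p * det ?A"
    by (rule det_permute_rows[OF _ p']) simp
  finally show ?thesis
    by (auto simp: sign_def)
qed

lemma list_minor_permute_rows:
  assumes "mset xs = mset xs'"
  shows "\<exists>c\<in>{1, -1}. list_minor xs ys = c * (list_minor xs' ys :: ('a \<times> 'b, 'k::comm_ring_1) mpolynomial)"
  unfolding list_minor_def by (rule det_permute_row_list[OF assms])

lemma list_minor_permute_cols:
  assumes "mset ys = mset ys'" "length xs = length ys"
  shows "\<exists>c\<in>{1, -1}. list_minor xs ys = c * (list_minor xs ys' :: ('a \<times> 'b, 'k::comm_ring_1) mpolynomial)"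
proof -
  have *: "list_minor xs zs = det (mat (length zs) (length zs) (\<lambda>(b, a). mvar (xs ! a, zs ! b)))"
    if "length zs = length xs" for zs :: "'b list"
    unfolding list_minor_def
    by (subst det_transpose[symmetric]) (auto simp: that intro!: arg_cong[where f = det])
  show ?thesis
    using det_permute_row_list[OF assms(1), of "\<lambda>y a. mvar (xs ! a, y)"] assms mset_eq_length[OF assms(1)]
    by (simp add: *)
qed

lemma mvars_det_subset:
  fixes A :: "('x, 'k::comm_ring_1) mpolynomial mat"
  assumes A: "A \<in> carrier_mat n n" and W: "\<And>a b. a < n \<Longrightarrow> b < n \<Longrightarrow> mvars (A $$ (a, b)) \<subseteq> W"
  shows "mvars (det A) \<subseteq> W"
  unfolding det_def'[OF A]
proof (rule mvars_sum_subset, rule mvars_mult_subset)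
  fix p assume "p \<in> {p. p permutes {0..<n}}"
  then have "p a < n" if "a < n" for a
    using permutes_in_image[of p "{0..<n}" a] that by simp
  then show "mvars (\<Prod>i = 0..<n. A $$ (i, p i)) \<subseteq> W"
    by (intro mvars_prod_subset W) auto
  show "mvars (signof p :: ('x, 'k) mpolynomial) \<subseteq> W"
    by (simp add: sign_def)
qed

lemma mvars_list_minor: "length ys = length xs \<Longrightarrow> mvars (list_minor xs ys) \<subseteq> set xs \<times> set ys"
  unfolding list_minor_def by (rule mvars_det_subset) (auto simp: mvars_mvar)

text \<open>Expansion along the last row.  For \<open>i\<close> and \<open>j\<close> not yet in \<open>xs\<close> and
  \<open>ys\<close>, the bounds on the variables of the remainder \<open>g\<close> say that \<open>z\<^sub>i\<^sub>j\<close> does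
  not occur in it: all its variables lie in a row of \<open>xs\<close> or a column of \<open>ys\<close>.\<close>

lemma list_minor_snoc:
  assumes len: "length ys = length xs"
  shows "\<exists>g. list_minor (xs @ [i]) (ys @ [j]) = mvar (i, j) * list_minor xs ys + (g :: ('a \<times> 'b, 'k::comm_ring_1) mpolynomial) \<and>
    mvars g \<subseteq> set xs \<times> UNIV \<union> UNIV \<times> set ys \<and> mvars g \<subseteq> set (xs @ [i]) \<times> set (ys @ [j])"
proof -
  let ?t = "length xs"
  define A :: "('a \<times> 'b, 'k) mpolynomial mat" where
    "A = mat (Suc ?t) (Suc ?t) (\<lambda>(a, b). mvar ((xs @ [i]) ! a, (ys @ [j]) ! b))"
  have A: "A \<in> carrier_mat (Suc ?t) (Suc ?t)" by (simp add: A_def)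
  define g where "g = (\<Sum>b<?t. A $$ (?t, b) * cofactor A ?t b)"
  have entry: "A $$ (a, b) = mvar ((xs @ [i]) ! a, (ys @ [j]) ! b)" if "a < Suc ?t" "b < Suc ?t" for a b
    using that by (simp add: A_def)
  have mem: "(xs @ [i]) ! a \<in> set (xs @ [i])" "(ys @ [j]) ! a \<in> set (ys @ [j])" if "a < Suc ?t" for a
    using that len by (intro nth_mem; simp)+
  have memx: "(xs @ [i]) ! a \<in> set xs" if "a < ?t" for a
    using that by (simp add: nth_append)
  have memy: "(ys @ [j]) ! a \<in> set ys" if "a < ?t" for a
    using that len by (simp add: nth_append)
  have upper: "mvars (A $$ (a, b)) \<subseteq> set xs \<times> set (ys @ [j])" if "a < ?t" "b < Suc ?t" for a b
    unfolding entry[OF less_SucI[OF that(1)] that(2)] mvars_mvar using memx[OF that(1)] mem(2)[OF that(2)] by blast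
  have cof: "mvars (cofactor A ?t b) \<subseteq> set xs \<times> set (ys @ [j])" if b: "b < Suc ?t" for b
    unfolding cofactor_def
  proof (rule mvars_mult_subset)
    show "mvars ((- 1) ^ (?t + b) :: ('a \<times> 'b, 'k) mpolynomial) \<subseteq> set xs \<times> set (ys @ [j])"
      by (rule mvars_power_subset) simp
    have "mat_delete A ?t b \<in> carrier_mat ?t ?t" using mat_delete_carrier[OF A] by simp
    then show "mvars (det (mat_delete A ?t b)) \<subseteq> set xs \<times> set (ys @ [j])"
      by (rule mvars_det_subset) (use A in \<open>simp add: mat_delete_def upper del: set_append\<close>)
  qed
  have delete: "mat_delete A ?t ?t = mat ?t ?t (\<lambda>(a, b). mvar (xs ! a, ys ! b))"
    by (rule eq_matI) (use A in \<open>auto simp: mat_delete_def entry nth_append len\<close>)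
  have "list_minor (xs @ [i]) (ys @ [j]) = det A"
    by (simp add: list_minor_def A_def)
  also have "\<dots> = (\<Sum>b<Suc ?t. A $$ (?t, b) * cofactor A ?t b)"
    by (rule laplace_expansion_row[OF A]) simp
  also have "\<dots> = mvar (i, j) * list_minor xs ys + g"
    by (simp add: g_def entry len nth_append cofactor_def delete list_minor_def)
  finally have "list_minor (xs @ [i]) (ys @ [j]) = mvar (i, j) * list_minor xs ys + g" .
  moreover have "mvars g \<subseteq> set xs \<times> UNIV \<union> UNIV \<times> set ys"
    unfolding g_def
  proof (intro mvars_sum_subset mvars_mult_subset)
    fix b assume "b \<in> {..<?t}"
    then have b: "b < ?t" by simp
    show "mvars (A $$ (?t, b)) \<subseteq> set xs \<times> UNIV \<union> UNIV \<times> set ys"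
      using b memy[OF b] by (simp add: entry mvars_mvar)
    show "mvars (cofactor A ?t b) \<subseteq> set xs \<times> UNIV \<union> UNIV \<times> set ys"
      using cof[of b] b by auto
  qed
  moreover have "mvars g \<subseteq> set (xs @ [i]) \<times> set (ys @ [j])"
    unfolding g_def
  proof (intro mvars_sum_subset mvars_mult_subset)
    fix b assume "b \<in> {..<?t}"
    then have b: "b < Suc ?t" by simp
    show "mvars (A $$ (?t, b)) \<subseteq> set (xs @ [i]) \<times> set (ys @ [j])"
      using b mem(2)[OF b] by (auto simp: entry mvars_mvar)
    show "mvars (cofactor A ?t b) \<subseteq> set (xs @ [i]) \<times> set (ys @ [j])"
      using cof[of b] b by auto
  qed
  ultimately show ?thesis by blast
qed

context prime_of_poly_ring_on
begin

lemma unit_mult_mem: "c \<in> {1, - 1} \<Longrightarrow> p \<in> P \<Longrightarrow> c * p \<in> P"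
  by (rule mult_mem) auto

end

lemma det_ideal_subset_iff:
  assumes "ideal Q (poly_ring_on T :: (nat \<times> nat, 'k::comm_ring_1) mpolynomial ring)"
  shows "det_ideal t T \<subseteq> Q \<longleftrightarrow> minors_in t T \<subseteq> Q"
proof -
  interpret R: cring "poly_ring_on T :: (nat \<times> nat, 'k) mpolynomial ring" by (rule cring_poly_ring_on)
  have "minors_in t T \<subseteq> carrier (poly_ring_on T :: (nat \<times> nat, 'k) mpolynomial ring)"
    by (auto simp: minors_in_def intro!: generic_minor_in_carrier)
  from R.genideal_self[OF this] show ?thesis
    using R.genideal_minimal[OF assms] unfolding det_ideal_def by blast
qed

text \<open>A largest minor outside \<open>P\<close> serves as the coefficient of each new variable in the next
  larger minors, which lie in \<open>P\<close>.\<close>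

lemma prime_height_det_ideal_ge:
  fixes P :: "(nat \<times> nat, 'k::comm_ring_1) mpolynomial set"
  assumes "finite I" "finite J"
    and P: "primeideal P (poly_ring_on (I \<times> J))" and minors: "minors_in (r + 1) (I \<times> J) \<subseteq> P"
  shows "enat ((card I - r) * (card J - r)) \<le> prime_height (poly_ring_on (I \<times> J)) P"
proof -
  interpret prime_of_poly_ring_on "I \<times> J" P by (rule prime_of_poly_ring_on.intro[OF P])
  define adm where "adm t xs ys \<longleftrightarrow> length xs = t \<and> length ys = t \<and> distinct xs \<and> distinct ys \<and>
      set xs \<subseteq> I \<and> set ys \<subseteq> J" for t :: nat and xs ys
  define vanish where "vanish t \<longleftrightarrow> (\<forall>xs ys. adm t xs ys \<longrightarrow> list_minor xs ys \<in> P)" for t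
  have "vanish (r + 1)"
    unfolding vanish_def
  proof (intro allI impI)
    fix xs ys assume "adm (r + 1) xs ys"
    then have xs: "distinct xs" "length xs = r + 1" "set xs \<subseteq> I" and
      ys: "distinct ys" "length ys = r + 1" "set ys \<subseteq> J"
      by (auto simp: adm_def)
    let ?xs = "sorted_list_of_set (set xs)" and ?ys = "sorted_list_of_set (set ys)"
    have card: "card (set xs) = r + 1" "card (set ys) = r + 1"
      using xs ys by (simp_all add: distinct_card)
    have "generic_minor (set xs) (set ys) \<in> minors_in (r + 1) (I \<times> J)"
      unfolding minors_in_def mem_Collect_eq
      by (rule exI[of _ "set xs"], rule exI[of _ "set ys"]) (use card xs ys in auto)
    then have "list_minor ?xs ?ys \<in> P"
      using minors card by (auto simp: generic_minor_eq_list_minor)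
    moreover have "mset xs = mset ?xs" "mset ys = mset ?ys"
      using xs ys by (auto simp: set_eq_iff_mset_eq_distinct[symmetric])
    then have "\<exists>c\<in>{1, - 1}. list_minor xs ys = c * (list_minor ?xs ys :: (nat \<times> nat, 'k) mpolynomial)"
      "\<exists>c\<in>{1, - 1}. list_minor ?xs ys = c * (list_minor ?xs ?ys :: (nat \<times> nat, 'k) mpolynomial)"
      using list_minor_permute_rows[of xs ?xs ys] list_minor_permute_cols[of ys ?ys ?xs] card ys by simp_all
    then obtain c d :: "(nat \<times> nat, 'k) mpolynomial" where "c \<in> {1, - 1}" "list_minor xs ys = c * list_minor ?xs ys"
      "d \<in> {1, - 1}" "list_minor ?xs ys = d * list_minor ?xs ?ys"
      by (elim bexE)
    ultimately show "list_minor xs ys \<in> P"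
      using unit_mult_mem by simp
  qed
  have not0: "\<not> vanish 0"
    using one_not_mem by (auto simp: vanish_def adm_def list_minor_def det_dim_zero)
  define t where "t = (LEAST t. vanish (t + 1))"
  have vanish_t: "vanish (t + 1)" and t: "t \<le> r"
    unfolding t_def using \<open>vanish (r + 1)\<close> by (rule LeastI, rule Least_le)
  have "\<not> vanish t"
  proof (cases t)
    case (Suc u)
    then show ?thesis using not_less_Least[of u "\<lambda>t. vanish (t + 1)"] by (simp add: t_def)
  qed (use not0 in simp)
  then obtain xs ys where adm: "adm t xs ys" and not_mem: "list_minor xs ys \<notin> P"
    by (auto simp: vanish_def)
  then have xs: "distinct xs" "length xs = t" "set xs \<subseteq> I" and ys: "distinct ys" "length ys = t" "set ys \<subseteq> J"
    by (auto simp: adm_def)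
  define R where "R = (I - set xs) \<times> (J - set ys)"
  have "finite R" using assms by (simp add: R_def)
  then obtain ps where ps: "distinct ps" "set ps = R" using finite_distinct_list by blast
  let ?N = "length ps"
  have N: "?N = (card I - t) * (card J - t)"
  proof -
    have "card (I - set xs) = card I - t" "card (J - set ys) = card J - t"
      using xs ys by (simp_all add: card_Diff_subset distinct_card)
    moreover have "?N = card R" using distinct_card[OF ps(1)] ps(2) by simp
    ultimately show ?thesis by (simp add: R_def card_cartesian_product)
  qed
  \<comment> \<open>The initial set \<open>I \<times> J - R\<close> consists of the positions in the rows \<open>xs\<close> or columns \<open>ys\<close>.\<close>
  define S where "S i = (I \<times> J - R) \<union> set (take i ps)" for i
  define f :: "nat \<Rightarrow> (nat \<times> nat, 'k) mpolynomial" where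
    "f i = list_minor (xs @ [fst (ps ! i)]) (ys @ [snd (ps ! i)])" for i
  have mem: "fst (ps ! i) \<in> I - set xs" "snd (ps ! i) \<in> J - set ys" if "i < ?N" for i
  proof -
    have "ps ! i \<in> R" using nth_mem[OF that] ps(2) by simp
    then show "fst (ps ! i) \<in> I - set xs" "snd (ps ! i) \<in> J - set ys"
      unfolding R_def mem_Times_iff by blast+
  qed
  have "enat ?N \<le> prime_height (poly_ring_on (I \<times> J)) P"
  proof (rule prime_height_ge)
    fix i assume i: "i < ?N"
    show "S i \<subseteq> S (Suc i)"
      using i by (auto simp: S_def take_Suc_conv_app_nth)
    show "f i \<in> P"
    proof -
      have "adm (t + 1) (xs @ [fst (ps ! i)]) (ys @ [snd (ps ! i)])"
        using mem[OF i] xs ys by (auto simp: adm_def)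
      then show ?thesis using vanish_t by (simp add: vanish_def f_def)
    qed
    obtain g where f: "f i = mvar (ps ! i) * list_minor xs ys + g"
      and g: "mvars g \<subseteq> set xs \<times> UNIV \<union> UNIV \<times> set ys"
        "mvars g \<subseteq> set (xs @ [fst (ps ! i)]) \<times> set (ys @ [snd (ps ! i)])"
      using list_minor_snoc[of ys xs "fst (ps ! i)" "snd (ps ! i)"] xs ys unfolding f_def by auto
    have gS: "mvars g \<subseteq> S i"
    proof -
      have "set (xs @ [fst (ps ! i)]) \<times> set (ys @ [snd (ps ! i)]) \<subseteq> I \<times> J"
        using mem[OF i] xs ys by (intro Sigma_mono) auto
      then have "mvars g \<subseteq> I \<times> J" using g(2) by (rule order_trans[rotated])
      moreover have "(set xs \<times> UNIV \<union> UNIV \<times> set ys) \<inter> R = {}" by (auto simp: R_def)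
      ultimately show ?thesis using g(1) unfolding S_def by blast
    qed
    have dS: "mvars (list_minor xs ys) \<subseteq> S i"
      using mvars_list_minor[of ys xs] xs ys by (fastforce simp: S_def R_def)
    have "S (Suc i) = insert (ps ! i) (S i)"
      using i by (auto simp: S_def take_Suc_conv_app_nth)
    then show "mvars (f i) \<subseteq> S (Suc i)"
      unfolding f using gS dS
      by (intro mvars_add_subset mvars_mult_subset) (auto simp: mvars_mvar)
    have "ps ! i \<notin> set (take i ps)"
      using ps(1) i by (auto simp: in_set_conv_nth nth_eq_iff_index_eq)
    then have notS: "ps ! i \<notin> S i"
      using mem[OF i] by (cases "ps ! i") (auto simp: S_def R_def)
    interpret split: comm_ring_hom "split_poly (S i) :: (nat \<times> nat, 'k) mpolynomial \<Rightarrow> _"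
      by (rule comm_ring_hom_split_poly)
    have "split_poly (S i) (f i) = Poly_Mapping.single (Poly_Mapping.single (ps ! i) 1) (list_minor xs ys) + Poly_Mapping.single 0 g"
      by (simp add: f split.hom_add split.hom_mult split_poly_mvar notS split_poly_const gS dS)
         (simp add: mvar_def mult_single)
    moreover have "Poly_Mapping.single (ps ! i) (1::nat) \<noteq> 0"
      by (metis lookup_single_eq lookup_zero zero_neq_one)
    ultimately show "Poly_Mapping.lookup (split_poly (S i) (f i)) (Poly_Mapping.single (ps ! i) 1) \<notin> P"
      using not_mem by (simp add: lookup_add lookup_single when_def)
  next
    show "S ?N = I \<times> J" using ps by (auto simp: S_def R_def)
  qed
  moreover have "(card I - r) * (card J - r) \<le> ?N"
    unfolding N using t by (intro mult_le_mono) auto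
  ultimately show ?thesis
    by (meson enat_ord_simps(1) order_trans)
qed

theorem ideal_height_det_ideal_ge:
  assumes "finite I" "finite J"
  shows "enat ((card I - r) * (card J - r)) \<le>
    ideal_height (poly_ring_on (I \<times> J) :: (nat \<times> nat, 'k::comm_ring_1) mpolynomial ring) (det_ideal (r + 1) (I \<times> J))"
  unfolding ideal_height_def
proof (rule Inf_greatest)
  fix h assume "h \<in> {prime_height (poly_ring_on (I \<times> J)) P | P :: (nat \<times> nat, 'k) mpolynomial set.
      primeideal P (poly_ring_on (I \<times> J)) \<and> det_ideal (r + 1) (I \<times> J) \<subseteq> P}"
  then obtain P :: "(nat \<times> nat, 'k) mpolynomial set" where
    P: "primeideal P (poly_ring_on (I \<times> J))" "det_ideal (r + 1) (I \<times> J) \<subseteq> P"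
    and h: "h = prime_height (poly_ring_on (I \<times> J)) P" by auto
  then show "enat ((card I - r) * (card J - r)) \<le> h"
    using prime_height_det_ideal_ge[OF assms P(1)] det_ideal_subset_iff[OF primeideal.axioms(1)[OF P(1)]]
    by simp
qed

section \<open>Dependent sets carry vectors normal to the rank variety\<close>

text \<open>The rows \<open>M e\<close>, for \<open>e \<in> E\<close>, span \<open>k\<^sup>W\<close> or have a common nonzero
  orthogonal vector.  The induction on \<open>W\<close> is Gaussian elimination of one column.\<close>

lemma fredholm_alternative:
  fixes M :: "'e \<Rightarrow> 'w \<Rightarrow> 'k::field"
  assumes "finite W" and "finite E"
  shows "(\<exists>y. (\<exists>w\<in>W. y w \<noteq> 0) \<and> (\<forall>e\<in>E. (\<Sum>w\<in>W. M e w * y w) = 0)) \<or>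
    (\<forall>b. \<exists>x. \<forall>w\<in>W. (\<Sum>e\<in>E. x e * M e w) = b w)"
  using assms(1)
proof (induction W arbitrary: M rule: finite_induct)
  case empty
  show ?case by simp
next
  case (insert v W)
  show ?case
  proof (cases "\<exists>e0\<in>E. M e0 v \<noteq> 0")
    case False
    have "(\<Sum>w\<in>insert v W. M e w * (if w = v then 1 else 0)) = 0" if "e \<in> E" for e
      using False that by (intro sum.neutral) auto
    then show ?thesis
      by (intro disjI1 exI[of _ "\<lambda>w. if w = v then 1 else 0"]) simp
  next
    case True
    then obtain e0 where e0: "e0 \<in> E" "M e0 v \<noteq> 0" by blast
    define q where "q e = M e v / M e0 v" for e
    define M' where "M' e w = M e w - q e * M e0 w" for e w
    have M: "M e w = M' e w + q e * M e0 w" for e w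
      by (simp add: M'_def)
    have q: "q e * M e0 v = M e v" for e
      using e0 by (simp add: q_def)
    consider (kernel) y where "\<exists>w\<in>W. y w \<noteq> 0" "\<forall>e\<in>E. (\<Sum>w\<in>W. M' e w * y w) = 0"
      | (solvable) "\<forall>b. \<exists>x. \<forall>w\<in>W. (\<Sum>e\<in>E. x e * M' e w) = b w"
      using insert.IH[of M'] by blast
    then show ?thesis
    proof cases
      case kernel
      define s where "s = (\<Sum>w\<in>W. M e0 w * y w)"
      define y' where "y' w = (if w = v then - s / M e0 v else y w)" for w
      have y': "y' v = - s / M e0 v" "\<And>w. w \<in> W \<Longrightarrow> y' w = y w"
        using insert.hyps by (auto simp: y'_def)
      have "(\<Sum>w\<in>insert v W. M e w * y' w) = 0" if "e \<in> E" for e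
      proof -
        have "(\<Sum>w\<in>W. M e w * y' w) = (\<Sum>w\<in>W. M' e w * y w) + q e * s"
          by (simp add: M[of e] y' distrib_right sum.distrib s_def sum_distrib_left mult.assoc)
        then show ?thesis
          using kernel(2) that insert.hyps by (simp add: y' q_def)
      qed
      moreover have "\<exists>w\<in>insert v W. y' w \<noteq> 0"
        using kernel(1) y'(2) by auto
      ultimately show ?thesis by blast
    next
      case solvable
      have "\<exists>x. \<forall>w\<in>insert v W. (\<Sum>e\<in>E. x e * M e w) = b w" for b
      proof -
        define n where "n = b v / M e0 v"
        obtain x where x: "\<And>w. w \<in> W \<Longrightarrow> (\<Sum>e\<in>E. x e * M' e w) = b w - n * M e0 w"
          using solvable[rule_format, of "\<lambda>w. b w - n * M e0 w"] by blast
        define l where "l = (\<Sum>e\<in>E. x e * q e)"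
        define x' where "x' e = x e + (if e = e0 then n - l else 0)" for e
        have x': "(\<Sum>e\<in>E. x' e * M e w) = (\<Sum>e\<in>E. x e * M e w) + (n - l) * M e0 w" for w
        proof -
          have "(\<Sum>e\<in>E. x' e * M e w) =
              (\<Sum>e\<in>E. x e * M e w) + (\<Sum>e\<in>E. if e = e0 then (n - l) * M e w else 0)"
            unfolding sum.distrib[symmetric] by (intro sum.cong refl) (simp add: x'_def distrib_right)
          then show ?thesis using e0 assms(2) by simp
        qed
        have split: "(\<Sum>e\<in>E. x e * M e w) = (\<Sum>e\<in>E. x e * M' e w) + l * M e0 w" for w
          unfolding l_def sum_distrib_right sum.distrib[symmetric]
          by (intro sum.cong refl) (simp add: M'_def algebra_simps)
        have "M' e v = 0" for e by (simp add: M'_def q)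
        then have "(\<Sum>e\<in>E. x' e * M e v) = n * M e0 v"
          by (simp add: x' split algebra_simps)
        then have "(\<Sum>e\<in>E. x' e * M e v) = b v"
          using e0 by (simp add: n_def)
        moreover have "(\<Sum>e\<in>E. x' e * M e w) = b w" if "w \<in> W" for w
          using x[OF that] by (simp add: x' split algebra_simps)
        ultimately show ?thesis by auto
      qed
      then show ?thesis by blast
    qed
  qed
qed

text \<open>Padding the factors by a zero column and a row makes them square.\<close>

lemma det_product_eq_0:
  fixes X Y :: "nat \<Rightarrow> nat \<Rightarrow> 'r::comm_ring_1"
  shows "det (mat (Suc r) (Suc r) (\<lambda>(a, b). \<Sum>k<r. X a k * Y k b)) = 0"
proof -
  define X' where "X' = mat (Suc r) (Suc r) (\<lambda>(a, k). if k < r then X a k else 0)"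
  define Y' where "Y' = mat (Suc r) (Suc r) (\<lambda>(k, b). Y k b)"
  have carrier: "X' \<in> carrier_mat (Suc r) (Suc r)" "Y' \<in> carrier_mat (Suc r) (Suc r)"
    by (simp_all add: X'_def Y'_def)
  have "mat (Suc r) (Suc r) (\<lambda>(a, b). \<Sum>k<r. X a k * Y k b) = X' * Y'"
    by (rule eq_matI) (simp_all add: X'_def Y'_def scalar_prod_def atLeast0LessThan)
  moreover have "det X' = 0"
    using laplace_expansion_column[OF carrier(1), of r] by (simp add: X'_def)
  ultimately show ?thesis
    by (simp add: det_mult[OF carrier])
qed

lemma subst_det_ideal_product:
  fixes c :: "'k::comm_ring_1 \<Rightarrow> 'r::comm_ring_1" and X Y :: "nat \<Rightarrow> nat \<Rightarrow> 'r"
  assumes "comm_ring_hom c" and "p \<in> det_ideal (r + 1) T"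
  shows "subst c (\<lambda>(i, j). \<Sum>k<r. X i k * Y k j) p = 0"
proof -
  interpret comm_ring_hom c by fact
  let ?h = "subst c (\<lambda>(i, j). \<Sum>k<r. X i k * Y k j)"
  interpret h: comm_ring_hom ?h by (rule comm_ring_hom_subst)
  let ?Q = "{p. mvars p \<subseteq> T \<and> ?h p = 0}"
  have Q: "ideal ?Q (poly_ring_on T)"
    by (rule ideal_poly_ring_onI) (auto simp: h.hom_add h.hom_mult mvars_add_subset mvars_mult_subset)
  have "minors_in (r + 1) T \<subseteq> ?Q"
  proof
    fix q :: "(nat \<times> nat, 'k) mpolynomial" assume "q \<in> minors_in (r + 1) T"
    then obtain I J where q: "q = generic_minor I J" and IJ: "finite I" "finite J"
      "card I = r + 1" "card J = r + 1" "I \<times> J \<subseteq> T"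
      by (auto simp: minors_in_def)
    have "?h q = det (map_mat ?h (mat (card I) (card J)
        (\<lambda>(a, b). mvar (sorted_list_of_set I ! a, sorted_list_of_set J ! b))))"
      by (simp add: q generic_minor_def)
    also have "\<dots> = det (mat (Suc r) (Suc r)
        (\<lambda>(a, b). \<Sum>k<r. X (sorted_list_of_set I ! a) k * Y k (sorted_list_of_set J ! b)))"
      by (rule arg_cong[where f = det], rule eq_matI) (simp_all add: IJ subst_mvar)
    also have "\<dots> = 0" by (rule det_product_eq_0)
    finally show "q \<in> ?Q"
      using generic_minor_in_carrier[of I J T] IJ by (simp add: q carrier_poly_ring_on)
  qed
  then show ?thesis
    using det_ideal_subset_iff[OF Q] assms(2) by blast
qed

lemma comm_ring_hom_const_poly: "comm_ring_hom (\<lambda>a. [:c a:])" if "comm_ring_hom c"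
proof -
  interpret comm_ring_hom c by fact
  show ?thesis by unfold_locales (simp_all add: hom_add hom_mult one_pCons)
qed

text \<open>The substitution \<open>x \<mapsto> x t + h\<^sub>x t\<^sup>2\<close> into a polynomial with lowest homogeneous part
  \<open>q\<^sub>d\<close> yields \<open>q\<^sub>d t\<^sup>d\<close> plus higher powers of \<open>t\<close>.  Comparing lowest terms in
  place of derivatives makes the argument work in every characteristic.\<close>

lemma subst_tangent_arc_nonzero:
  fixes q :: "('x, 'k::comm_ring_1) mpolynomial" and h :: "'x \<Rightarrow> ('x, 'k) mpolynomial"
  assumes "q \<noteq> 0"
  shows "subst (\<lambda>a. [:Poly_Mapping.single 0 a:]) (\<lambda>x. [:0, mvar x, h x:]) q \<noteq> 0"
proof -
  define deg where "deg u = (\<Sum>x\<in>Poly_Mapping.keys u. Poly_Mapping.lookup u x)" for u :: "'x \<Rightarrow>\<^sub>0 nat"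
  let ?K = "Poly_Mapping.keys q"
  have "deg ` ?K \<noteq> {}" using assms by simp
  then have "Min (deg ` ?K) \<in> deg ` ?K" by (intro Min_in) auto
  then obtain u0 where u0: "u0 \<in> ?K" "deg u0 = Min (deg ` ?K)" by auto
  have min: "deg u0 \<le> deg u" if "u \<in> ?K" for u
    using that by (simp add: u0(2))
  have factor: "monom_value (\<lambda>x. [:0, mvar x, h x:]) u =
      monom 1 (deg u) * monom_value (\<lambda>x. [:mvar x, h x:]) u" for u
  proof -
    have "[:0, mvar x, h x:] = [:0, 1:] * [:mvar x, h x:]" for x
      by simp
    then show ?thesis
      by (simp only: monom_value_def power_mult_distrib prod.distrib deg_def monom_altdef power_sum smult_1_left)
  qed
  have coeff_0: "coeff (monom_value (\<lambda>x. [:mvar x, h x:]) u) 0 = Poly_Mapping.single u 1" for u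
    by (simp add: monom_value_def poly_prod flip: poly_0_coeff_0 monom_value_mvar)
  have "coeff (subst (\<lambda>a. [:Poly_Mapping.single 0 a:]) (\<lambda>x. [:0, mvar x, h x:]) q) (deg u0) =
      (\<Sum>u\<in>?K. if deg u = deg u0 then Poly_Mapping.single u (Poly_Mapping.lookup q u) else 0)"
    unfolding subst_def coeff_sum factor
  proof (rule sum.cong[OF refl])
    fix u assume "u \<in> ?K"
    then show "coeff ([:Poly_Mapping.single 0 (Poly_Mapping.lookup q u):] *
        (monom 1 (deg u) * monom_value (\<lambda>x. [:mvar x, h x:]) u)) (deg u0) =
        (if deg u = deg u0 then Poly_Mapping.single u (Poly_Mapping.lookup q u) else 0)"
      using min[of u] by (simp add: coeff_monom_mult coeff_0 mult_single)
  qed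
  moreover have "Poly_Mapping.lookup \<dots> u0 = Poly_Mapping.lookup q u0"
  proof -
    have "Poly_Mapping.lookup (\<Sum>u\<in>?K. if deg u = deg u0 then Poly_Mapping.single u (Poly_Mapping.lookup q u) else 0) u0
      = (\<Sum>u\<in>?K. if u = u0 then Poly_Mapping.lookup q u0 else 0)"
      unfolding lookup_sum by (rule sum.cong) (auto simp: lookup_single when_def)
    then show ?thesis using u0 by simp
  qed
  moreover have "Poly_Mapping.lookup q u0 \<noteq> 0"
    using u0(1) by (simp add: in_keys_iff)
  ultimately have "Poly_Mapping.lookup (coeff (subst (\<lambda>a. [:Poly_Mapping.single 0 a:])
      (\<lambda>x. [:0, mvar x, h x:]) q) (deg u0)) u0 \<noteq> 0"
    by (simp only: not_False_eq_True)
  then show ?thesis by auto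
qed

text \<open>Translation by the constant terms \<open>c\<close> reduces to arcs through the origin.\<close>

lemma subst_product_arc_nonzero:
  fixes p :: "(nat \<times> nat, 'k::comm_ring_1) mpolynomial"
  assumes "p \<noteq> 0" and vars: "mvars p \<subseteq> W"
    and Q: "\<And>w. w \<in> W \<Longrightarrow> Q w = [:Poly_Mapping.single 0 (c w), mvar w, h w:]"
  shows "subst (\<lambda>a. [:Poly_Mapping.single 0 a:]) Q p \<noteq> 0"
proof -
  let ?C = "Poly_Mapping.single 0 :: 'k \<Rightarrow> (nat \<times> nat, 'k) mpolynomial"
  let ?c = "\<lambda>a. [:?C a:]"
  interpret C: comm_ring_hom ?C by (rule comm_ring_hom_single_0)
  interpret c: comm_ring_hom ?c by (rule comm_ring_hom_const_poly[OF comm_ring_hom_single_0])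
  define shift where "shift = subst ?C (\<lambda>w. mvar w + ?C (c w))"
  define unshift where "unshift = subst ?C (\<lambda>w. mvar w - ?C (c w))"
  interpret unshift: comm_ring_hom unshift unfolding unshift_def by (rule C.comm_ring_hom_subst)
  have "unshift (shift p) = subst (unshift \<circ> ?C) (unshift \<circ> (\<lambda>w. mvar w + ?C (c w))) p"
    unfolding shift_def by (rule comm_ring_hom_comp_subst[OF unshift.comm_ring_hom_axioms])
  also have "unshift \<circ> ?C = ?C"
    by (auto simp: unshift_def C.subst_single)
  also have "unshift \<circ> (\<lambda>w. mvar w + ?C (c w)) = mvar"
    by (simp add: comp_def unshift.hom_add) (simp add: unshift_def C.subst_single C.subst_mvar)
  finally have "shift p \<noteq> 0"
    using \<open>p \<noteq> 0\<close> unshift.hom_zero by (auto simp: subst_mvar_id)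
  let ?arc = "subst ?c (\<lambda>w. [:0, mvar w, h w:])"
  interpret arc: comm_ring_hom ?arc by (rule c.comm_ring_hom_subst)
  have "?arc (shift p) = subst (?arc \<circ> ?C) (?arc \<circ> (\<lambda>w. mvar w + ?C (c w))) p"
    unfolding shift_def by (rule comm_ring_hom_comp_subst[OF arc.comm_ring_hom_axioms])
  also have "?arc \<circ> ?C = ?c"
    by (auto simp: c.subst_single)
  also have "subst ?c (?arc \<circ> (\<lambda>w. mvar w + ?C (c w))) p = subst ?c Q p"
    using Q vars by (intro subst_cong) (auto simp: arc.hom_add c.subst_single c.subst_mvar)
  finally show ?thesis
    using subst_tangent_arc_nonzero[OF \<open>shift p \<noteq> 0\<close>, of h] by simp
qed

text \<open>\<open>Y\<close> is orthogonal to all tangent vectors \<open>A' B + A B'\<close> of the rank variety at the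
  product \<open>A B\<close>, where \<open>A\<close> is \<open>m \<times> r\<close> and \<open>B\<close> is \<open>r \<times> n\<close>.\<close>

definition normal_vectors_exist :: "'k::field itself \<Rightarrow> nat \<Rightarrow> nat \<Rightarrow> nat \<Rightarrow> (nat \<times> nat) set \<Rightarrow> bool" where
  "normal_vectors_exist K r m n \<Omega> \<longleftrightarrow> (\<forall>(A :: nat \<Rightarrow> nat \<Rightarrow> 'k) B. \<exists>Y.
    (\<exists>w\<in>\<Omega>. Y w \<noteq> 0) \<and> (\<forall>w. w \<notin> \<Omega> \<longrightarrow> Y w = 0) \<and>
    (\<forall>i\<in>{1..m}. \<forall>k<r. (\<Sum>j=1..n. B k j * Y (i, j)) = 0) \<and>
    (\<forall>j\<in>{1..n}. \<forall>k<r. (\<Sum>i=1..m. A i k * Y (i, j)) = 0))"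

text \<open>If for some \<open>A\<close>, \<open>B\<close> there were no such \<open>Y\<close>, every unit vector of \<open>k\<^sup>\<Omega>\<close> would be
  the restriction of a tangent vector.  Combining the corresponding directions with the variables as
  coefficients gives an arc of products \<open>(A + t A') (B + t B')\<close> whose entries on
  \<open>\<Omega>\<close> are \<open>c\<^sub>i\<^sub>j + z\<^sub>i\<^sub>j t\<close> up to order \<open>t\<^sup>2\<close>.  No nonzero polynomial in
  \<open>Z\<^sub>\<Omega>\<close> vanishes on this arc, but all elements of the determinantal ideal do.\<close>

lemma dependent_imp_normal_vectors_exist:
  assumes dep: "det_matroid_dep TYPE('k::field) r m n \<Omega>"
  shows "normal_vectors_exist TYPE('k) r m n \<Omega>"
  unfolding normal_vectors_exist_def
proof (intro allI)
  fix A B :: "nat \<Rightarrow> nat \<Rightarrow> 'k"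
  let ?G = "{1..m} \<times> {1..n}"
  let ?C = "Poly_Mapping.single 0 :: 'k \<Rightarrow> (nat \<times> nat, 'k) mpolynomial"
  let ?c = "\<lambda>a. [:?C a:]"
  interpret C: comm_ring_hom ?C by (rule comm_ring_hom_single_0)
  have \<Omega>: "\<Omega> \<subseteq> ?G" and "(det_ideal (r + 1) ?G :: (nat \<times> nat, 'k) mpolynomial set)
       \<inter> carrier (poly_ring_on \<Omega>) \<noteq> {0}"
    using dep by (auto simp: det_matroid_dep_def det_matroid_indep_def det_matroid_ground_def)
  moreover have "0 \<in> (det_ideal (r + 1) ?G :: (nat \<times> nat, 'k) mpolynomial set)"
  proof -
    interpret R: cring "poly_ring_on ?G :: (nat \<times> nat, 'k) mpolynomial ring" by (rule cring_poly_ring_on)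
    have "minors_in (r + 1) ?G \<subseteq> carrier (poly_ring_on ?G :: (nat \<times> nat, 'k) mpolynomial ring)"
      by (auto simp: minors_in_def intro!: generic_minor_in_carrier)
    then have "ideal (det_ideal (r + 1) ?G) (poly_ring_on ?G :: (nat \<times> nat, 'k) mpolynomial ring)"
      unfolding det_ideal_def by (rule R.genideal_ideal)
    then show ?thesis
      using additive_subgroup.zero_closed[OF ideal.axioms(1)] by (fastforce simp: poly_ring_on_simps)
  qed
  ultimately obtain p :: "(nat \<times> nat, 'k) mpolynomial" where
    p: "p \<in> det_ideal (r + 1) ?G" "mvars p \<subseteq> \<Omega>" "p \<noteq> 0"
    by (auto simp: carrier_poly_ring_on)
  have fin: "finite \<Omega>" using \<Omega> by (rule finite_subset) simp
  \<comment> \<open>The index set of the entries of \<open>A'\<close> and \<open>B'\<close>; row \<open>e\<close> of \<open>M\<close> is the tangent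
    vector obtained by perturbing the entry \<open>e\<close> alone.\<close>
  define E where "E = ({1..m} \<times> {..<r}) <+> ({..<r} \<times> {1..n})"
  define M where "M e w = (case e of Inl (i, k) \<Rightarrow> if i = fst w then B k (snd w) else 0
      | Inr (k, j) \<Rightarrow> if j = snd w then A (fst w) k else 0)" for e w
  have M_sum: "(\<Sum>e\<in>E. x e * M e (i, j)) =
      (\<Sum>k<r. A i k * x (Inr (k, j)) + x (Inl (i, k)) * B k j)" if "(i, j) \<in> ?G" for x i j
  proof -
    have "(\<Sum>e\<in>{1..m} \<times> {..<r}. x (Inl e) * M (Inl e) (i, j)) =
        (\<Sum>i'\<in>{1..m}. if i' = i then \<Sum>k<r. x (Inl (i', k)) * B k j else 0)"
      unfolding sum.cartesian_product' by (intro sum.cong refl) (auto simp: M_def)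
    moreover have "(\<Sum>e\<in>{..<r} \<times> {1..n}. x (Inr e) * M (Inr e) (i, j)) =
        (\<Sum>k<r. \<Sum>j'\<in>{1..n}. if j' = j then x (Inr (k, j')) * A i k else 0)"
      unfolding sum.cartesian_product' by (intro sum.cong refl) (auto simp: M_def)
    ultimately have "(\<Sum>e\<in>E. x e * M e (i, j)) =
        (\<Sum>i'\<in>{1..m}. if i' = i then \<Sum>k<r. x (Inl (i', k)) * B k j else 0) +
        (\<Sum>k<r. \<Sum>j'\<in>{1..n}. if j' = j then x (Inr (k, j')) * A i k else 0)"
      unfolding E_def by (subst sum.Plus) (auto simp: comp_def)
    then show ?thesis
      using that by (simp add: sum.distrib mult.commute add.commute)
  qed
  have "\<not> (\<forall>b. \<exists>x. \<forall>w\<in>\<Omega>. (\<Sum>e\<in>E. x e * M e w) = b w)"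
  proof
    assume "\<forall>b. \<exists>x. \<forall>w\<in>\<Omega>. (\<Sum>e\<in>E. x e * M e w) = b w"
    then have "\<exists>x. \<forall>w\<in>\<Omega>. (\<Sum>e\<in>E. x e * M e w) = (if w = v then 1 else 0)" for v
      by (rule spec)
    then obtain x where x: "\<And>v w. w \<in> \<Omega> \<Longrightarrow> (\<Sum>e\<in>E. x v e * M e w) = (if w = v then 1 else 0)"
      by metis
    define X where "X i k = [:?C (A i k), \<Sum>v\<in>\<Omega>. ?C (x v (Inl (i, k))) * mvar v:]" for i k
    define Y where "Y k j = [:?C (B k j), \<Sum>v\<in>\<Omega>. ?C (x v (Inr (k, j))) * mvar v:]" for k j
    define Q where "Q = (\<lambda>(i, j). \<Sum>k<r. X i k * Y k j)"
    define c where "c = (\<lambda>(i, j). \<Sum>k<r. A i k * B k j)"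
    define h where "h = (\<lambda>(i, j). \<Sum>k<r. (\<Sum>v\<in>\<Omega>. ?C (x v (Inl (i, k))) * mvar v) *
      (\<Sum>v\<in>\<Omega>. ?C (x v (Inr (k, j))) * mvar v))"
    have "subst ?c Q p = 0"
      unfolding Q_def
      by (rule subst_det_ideal_product[OF comm_ring_hom_const_poly[OF comm_ring_hom_single_0] p(1)])
    moreover have "subst ?c Q p \<noteq> 0"
    proof (rule subst_product_arc_nonzero[OF p(3,2)])
      fix w assume w: "w \<in> \<Omega>"
      obtain i j where ij: "w = (i, j)" by force
      have lin: "(\<Sum>k<r. ?C (A i k) * (\<Sum>v\<in>\<Omega>. ?C (x v (Inr (k, j))) * mvar v) +
          (\<Sum>v\<in>\<Omega>. ?C (x v (Inl (i, k))) * mvar v) * ?C (B k j)) = mvar w"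
      proof -
        have "(\<Sum>k<r. ?C (A i k) * (\<Sum>v\<in>\<Omega>. ?C (x v (Inr (k, j))) * mvar v) +
            (\<Sum>v\<in>\<Omega>. ?C (x v (Inl (i, k))) * mvar v) * ?C (B k j)) =
            (\<Sum>k<r. \<Sum>v\<in>\<Omega>. ?C (A i k * x v (Inr (k, j)) + x v (Inl (i, k)) * B k j) * mvar v)"
          by (simp add: sum_distrib_left sum_distrib_right C.hom_add C.hom_mult sum.distrib algebra_simps)
        also have "\<dots> = (\<Sum>v\<in>\<Omega>. ?C (\<Sum>k<r. A i k * x v (Inr (k, j)) + x v (Inl (i, k)) * B k j) * mvar v)"
          by (subst sum.swap) (simp add: C.hom_sum sum_distrib_right)
        also have "\<dots> = (\<Sum>v\<in>\<Omega>. if w = v then mvar v else 0)"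
          using x[OF w] M_sum[of i j] w \<Omega> ij by (intro sum.cong refl) (auto split: if_splits)
        finally show ?thesis using w fin by simp
      qed
      have "X i k * Y k j = [:?C (A i k) * ?C (B k j),
          ?C (A i k) * (\<Sum>v\<in>\<Omega>. ?C (x v (Inr (k, j))) * mvar v) +
            (\<Sum>v\<in>\<Omega>. ?C (x v (Inl (i, k))) * mvar v) * ?C (B k j),
          (\<Sum>v\<in>\<Omega>. ?C (x v (Inl (i, k))) * mvar v) * (\<Sum>v\<in>\<Omega>. ?C (x v (Inr (k, j))) * mvar v):]" for k
        by (simp add: X_def Y_def ac_simps)
      moreover have "(\<Sum>k<r. [:f k, g k, h k:]) = [:sum f {..<r}, sum g {..<r}, sum h {..<r}:]"
        for f g h :: "nat \<Rightarrow> (nat \<times> nat, 'k) mpolynomial"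
        by (induction r) simp_all
      ultimately have "Q w = [:\<Sum>k<r. ?C (A i k) * ?C (B k j), mvar w, h w:]"
        by (simp add: Q_def ij h_def lin[unfolded ij])
      then show "Q w = [:?C (c w), mvar w, h w:]"
        by (simp add: c_def ij C.hom_sum C.hom_mult)
    qed
    ultimately show False by simp
  qed
  moreover have "finite E" by (simp add: E_def)
  ultimately obtain y where y: "\<exists>w\<in>\<Omega>. y w \<noteq> 0" "\<And>e. e \<in> E \<Longrightarrow> (\<Sum>w\<in>\<Omega>. M e w * y w) = 0"
    using fredholm_alternative[OF fin, of E M] by blast
  define Y where "Y w = (if w \<in> \<Omega> then y w else 0)" for w
  have E_sum: "(\<Sum>i=1..m. \<Sum>j=1..n. M e (i, j) * Y (i, j)) = 0" if "e \<in> E" for e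
  proof -
    have "(\<Sum>w\<in>?G. M e w * Y w) = (\<Sum>w\<in>\<Omega>. M e w * y w)"
      by (rule sum.mono_neutral_cong_right) (use \<Omega> in \<open>auto simp: Y_def\<close>)
    then show ?thesis using y(2)[OF that] by (simp add: sum.cartesian_product)
  qed
  have "(\<Sum>j=1..n. B k j * Y (i, j)) = 0" if "i \<in> {1..m}" "k < r" for i k
  proof -
    have "(\<Sum>i'=1..m. \<Sum>j=1..n. M (Inl (i, k)) (i', j) * Y (i', j)) =
        (\<Sum>i'=1..m. if i = i' then \<Sum>j=1..n. B k j * Y (i', j) else 0)"
      by (intro sum.cong refl) (auto simp: M_def)
    moreover have "Inl (i, k) \<in> E" using that by (auto simp: E_def)
    ultimately show ?thesis using E_sum[of "Inl (i, k)"] that by simp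
  qed
  moreover have "(\<Sum>i=1..m. A i k * Y (i, j)) = 0" if "j \<in> {1..n}" "k < r" for j k
  proof -
    have "(\<Sum>i=1..m. \<Sum>j'=1..n. M (Inr (k, j)) (i, j') * Y (i, j')) =
        (\<Sum>i=1..m. \<Sum>j'=1..n. if j = j' then A i k * Y (i, j') else 0)"
      by (intro sum.cong refl) (auto simp: M_def)
    moreover have "Inr (k, j) \<in> E" using that by (auto simp: E_def)
    ultimately show ?thesis using E_sum[of "Inr (k, j)"] that by simp
  qed
  moreover have "\<exists>w\<in>\<Omega>. Y w \<noteq> 0" "\<forall>w. w \<notin> \<Omega> \<longrightarrow> Y w = 0"
    using y(1) by (auto simp: Y_def)
  ultimately show "\<exists>Y. (\<exists>w\<in>\<Omega>. Y w \<noteq> 0) \<and> (\<forall>w. w \<notin> \<Omega> \<longrightarrow> Y w = 0) \<and>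
      (\<forall>i\<in>{1..m}. \<forall>k<r. (\<Sum>j=1..n. B k j * Y (i, j)) = 0) \<and>
      (\<forall>j\<in>{1..n}. \<forall>k<r. (\<Sum>i=1..m. A i k * Y (i, j)) = 0)"
    by blast
qed

section \<open>Normal vectors force dense blocks\<close>

lemma normal_vectors_existE:
  fixes A B :: "nat \<Rightarrow> nat \<Rightarrow> 'k::field"
  assumes "normal_vectors_exist TYPE('k) r m n \<Omega>"
  obtains Y where "\<exists>w\<in>\<Omega>. Y w \<noteq> 0" "\<forall>w. w \<notin> \<Omega> \<longrightarrow> Y w = 0"
    "\<forall>i\<in>{1..m}. \<forall>k<r. (\<Sum>j=1..n. B k j * Y (i, j)) = 0"
    "\<forall>j\<in>{1..n}. \<forall>k<r. (\<Sum>i=1..m. A i k * Y (i, j)) = 0"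
  using spec[OF spec[OF assms[unfolded normal_vectors_exist_def], where x = A], where x = B] that by blast

definition dense_block :: "nat \<Rightarrow> nat \<Rightarrow> nat \<Rightarrow> (nat \<times> nat) set \<Rightarrow> bool" where
  "dense_block r m n \<Omega> \<longleftrightarrow> (\<exists>I\<subseteq>{1..m}. \<exists>J\<subseteq>{1..n}. r < card I \<and> r < card J \<and>
    card (I \<times> J - \<Omega>) < (card I - r) * (card J - r))"

lemma dense_blockI:
  assumes "I \<subseteq> {1..m}" "J \<subseteq> {1..n}" "r < card I" "r < card J"
    "card (I \<times> J - \<Omega>) < (card I - r) * (card J - r)"
  shows "dense_block r m n \<Omega>"
  using assms unfolding dense_block_def by blast

lemma normal_vectors_exist_transpose:
  assumes "normal_vectors_exist TYPE('k::field) r m n \<Omega>"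
  shows "normal_vectors_exist TYPE('k) r n m (\<Omega>\<inverse>)"
  unfolding normal_vectors_exist_def
proof (intro allI)
  fix A B :: "nat \<Rightarrow> nat \<Rightarrow> 'k"
  obtain Y where Y: "\<exists>w\<in>\<Omega>. Y w \<noteq> 0" "\<forall>w. w \<notin> \<Omega> \<longrightarrow> Y w = 0"
    "\<forall>i\<in>{1..m}. \<forall>k<r. (\<Sum>j=1..n. A j k * Y (i, j)) = 0"
    "\<forall>j\<in>{1..n}. \<forall>k<r. (\<Sum>i=1..m. B k i * Y (i, j)) = 0"
    by (rule normal_vectors_existE[OF assms, where B = "\<lambda>k j. A j k" and A = "\<lambda>i k. B k i"])
  have "\<exists>w\<in>\<Omega>\<inverse>. (Y \<circ> prod.swap) w \<noteq> 0"
    using Y(1) by force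
  moreover have "\<forall>w. w \<notin> \<Omega>\<inverse> \<longrightarrow> (Y \<circ> prod.swap) w = 0"
    using Y(2) by auto
  ultimately show "\<exists>Y. (\<exists>w\<in>\<Omega>\<inverse>. Y w \<noteq> 0) \<and> (\<forall>w. w \<notin> \<Omega>\<inverse> \<longrightarrow> Y w = 0) \<and>
      (\<forall>i\<in>{1..n}. \<forall>k<r. (\<Sum>j=1..m. B k j * Y (i, j)) = 0) \<and>
      (\<forall>j\<in>{1..m}. \<forall>k<r. (\<Sum>i=1..n. A i k * Y (i, j)) = 0)"
    using Y(3,4) by (intro exI[of _ "Y \<circ> prod.swap"]) simp
qed

lemma dense_block_transpose:
  assumes "dense_block r m n (\<Omega>\<inverse>)"
  shows "dense_block r n m \<Omega>"
proof -
  obtain I J where IJ: "I \<subseteq> {1..m}" "J \<subseteq> {1..n}" "r < card I" "r < card J"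
    "card (I \<times> J - \<Omega>\<inverse>) < (card I - r) * (card J - r)"
    using assms unfolding dense_block_def by blast
  have "J \<times> I - \<Omega> = prod.swap ` (I \<times> J - \<Omega>\<inverse>)" by force
  then have "card (J \<times> I - \<Omega>) = card (I \<times> J - \<Omega>\<inverse>)"
    by (simp add: card_image)
  then show ?thesis
    using IJ by (intro dense_blockI[of J n I m]) (simp_all add: mult.commute)
qed

lemma two_nonzero_summands:
  fixes f :: "'a \<Rightarrow> 'k::comm_monoid_add"
  assumes "finite S" "sum f S = 0" "a \<in> S" "f a \<noteq> 0"
  shows "2 \<le> card {b \<in> S. f b \<noteq> 0}"
proof -
  have "\<exists>b\<in>S. b \<noteq> a \<and> f b \<noteq> 0"
  proof (rule ccontr)
    assume "\<not> ?thesis"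
    then have "sum f S = sum f {a}"
      using assms by (intro sum.mono_neutral_right) auto
    then show False using assms by simp
  qed
  then obtain b where "b \<in> S" "b \<noteq> a" "f b \<noteq> 0" by blast
  then have "card {a, b} \<le> card {b \<in> S. f b \<noteq> 0}"
    using assms by (intro card_mono) auto
  then show ?thesis using \<open>b \<noteq> a\<close> by simp
qed

text \<open>With all entries of \<open>A\<close> and \<open>B\<close> equal to 1, the rows and columns of \<open>Y\<close> sum to 0, so each
  nonzero one has at least two nonzero entries.  Counting by rows and by columns, the support has at
  least \<open>|I| + |J|\<close> elements, and \<open>|I| |J| - (|I| + |J|) < (|I| - 1) (|J| - 1)\<close>.\<close>

lemma dense_block_rank_1:
  assumes ex: "normal_vectors_exist TYPE('k::field) 1 m n \<Omega>" and \<Omega>: "\<Omega> \<subseteq> {1..m} \<times> {1..n}"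
  shows "dense_block 1 m n \<Omega>"
proof -
  obtain Y :: "nat \<times> nat \<Rightarrow> 'k" where Y: "\<exists>w\<in>\<Omega>. Y w \<noteq> 0" "\<forall>w. w \<notin> \<Omega> \<longrightarrow> Y w = 0"
    and "\<forall>i\<in>{1..m}. \<forall>k<1::nat. (\<Sum>j=1..n. 1 * Y (i, j)) = 0"
    and "\<forall>j\<in>{1..n}. \<forall>k<1::nat. (\<Sum>i=1..m. 1 * Y (i, j)) = 0"
    by (rule normal_vectors_existE[OF ex, where B = "\<lambda>_ _. 1" and A = "\<lambda>_ _. 1"])
  then have rows: "\<And>i. i \<in> {1..m} \<Longrightarrow> (\<Sum>j=1..n. Y (i, j)) = 0"
    and cols: "\<And>j. j \<in> {1..n} \<Longrightarrow> (\<Sum>i=1..m. Y (i, j)) = 0"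
    by simp_all
  define E where "E = {w. Y w \<noteq> 0}"
  define R where "R i = {j \<in> {1..n}. Y (i, j) \<noteq> 0}" for i
  define C where "C j = {i \<in> {1..m}. Y (i, j) \<noteq> 0}" for j
  define I where "I = fst ` E"
  define J where "J = snd ` E"
  have E\<Omega>: "E \<subseteq> \<Omega>" using Y(2) by (auto simp: E_def)
  then have EG: "E \<subseteq> {1..m} \<times> {1..n}" using \<Omega> by blast
  have I: "I \<subseteq> {1..m}" and J: "J \<subseteq> {1..n}" using EG by (auto simp: I_def J_def)
  have fin: "finite I" "finite J" using finite_subset[OF I] finite_subset[OF J] by simp_all
  have R: "2 \<le> card (R i)" if i: "i \<in> I" for i
  proof -
    obtain j where "(i, j) \<in> E" using i by (auto simp: I_def)
    then show ?thesis
      using EG two_nonzero_summands[of "{1..n}" "\<lambda>j. Y (i, j)" j] rows[of i] by (auto simp: R_def E_def)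
  qed
  have C: "2 \<le> card (C j)" if j: "j \<in> J" for j
  proof -
    obtain i where "(i, j) \<in> E" using j by (auto simp: J_def)
    then show ?thesis
      using EG two_nonzero_summands[of "{1..m}" "\<lambda>i. Y (i, j)" i] cols[of j] by (auto simp: C_def E_def)
  qed
  have "E = Sigma I R" using EG by (force simp: E_def I_def R_def)
  then have "card E = (\<Sum>i\<in>I. card (R i))" using fin by (simp add: R_def)
  then have EI: "2 * card I \<le> card E"
    using sum_mono[of I "\<lambda>_. 2" "\<lambda>i. card (R i)"] R by simp
  have "E = prod.swap ` Sigma J C" using EG by (force simp: E_def J_def C_def image_iff)
  then have "card E = card (Sigma J C)" by (simp add: card_image)
  then have "card E = (\<Sum>j\<in>J. card (C j))" using fin by (simp add: C_def)
  then have EJ: "2 * card J \<le> card E"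
    using sum_mono[of J "\<lambda>_. 2" "\<lambda>j. card (C j)"] C by simp
  obtain i j where ij: "(i, j) \<in> E" using Y(1) by (auto simp: E_def)
  have "R i \<subseteq> J" "C j \<subseteq> I" by (force simp: R_def C_def I_def J_def E_def)+
  then have "2 \<le> card I" "2 \<le> card J"
    using R[of i] C[of j] ij card_mono[OF fin(1), of "C j"] card_mono[OF fin(2), of "R i"]
    by (force simp: I_def J_def)+
  then obtain a b where ab: "card I = a + 2" "card J = b + 2"
    by (metis add.commute le_Suc_ex)
  have EIJ: "E \<subseteq> I \<times> J" by (force simp: I_def J_def)
  have "card (I \<times> J - \<Omega>) \<le> card (I \<times> J - E)"
    using E\<Omega> fin by (intro card_mono) auto
  also have "\<dots> = card I * card J - card E"
    using EIJ fin by (simp add: card_Diff_subset finite_subset card_cartesian_product)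
  also have "\<dots> < (card I - 1) * (card J - 1)"
    using EI EJ by (simp add: ab algebra_simps)
  finally have "card (I \<times> J - \<Omega>) < (card I - 1) * (card J - 1)" .
  then show ?thesis
    by (intro dense_blockI[OF I J]) (simp_all add: ab)
qed

text \<open>The kernel consists of the values \<open>a + b s\<^sub>i\<close> of affine functions at distinct points
  \<open>s\<^sub>i\<close> of the field, and an affine function with two zeros vanishes.\<close>

lemma two_dimensional_kernel:
  assumes "infinite (UNIV :: 'k::field set)"
  obtains A :: "nat \<Rightarrow> nat \<Rightarrow> 'k::field" where
    "\<forall>y. (\<forall>k<r. (\<Sum>i=1..r+2. A i k * y i) = 0) \<longrightarrow>
      (\<forall>i\<in>{1..r+2}. \<forall>i'\<in>{1..r+2}. i \<noteq> i' \<and> y i = 0 \<and> y i' = 0 \<longrightarrow> (\<forall>l\<in>{1..r+2}. y l = 0))"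
proof -
  obtain s :: "nat \<Rightarrow> 'k" where s: "inj s"
    using infinite_countable_subset[OF assms] by blast
  then have s_eq: "s i = s j \<longleftrightarrow> i = j" for i j by (simp add: inj_eq)
  \<comment> \<open>The \<open>k\<close>-th relation says that the values at the points \<open>s\<^sub>1\<close>, \<open>s\<^sub>2\<close> and \<open>s\<^sub>k\<^sub>+\<^sub>3\<close>
    lie on a line.\<close>
  define A where "A i k = (if i = k + 3 then s 1 - s 2 else 0) +
      ((if i = 1 then s 2 - s (k + 3) else 0) + (if i = 2 then s (k + 3) - s 1 else 0))" for i k
  show thesis
  proof (rule that[of A], safe)
    fix y :: "nat \<Rightarrow> 'k" and i i' l
    assume ker: "\<forall>k<r. (\<Sum>i=1..r+2. A i k * y i) = 0"
      and i: "i \<in> {1..r+2}" "i' \<in> {1..r+2}" "i \<noteq> i'" "y i = 0" "y i' = 0" and l: "l \<in> {1..r+2}"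
    define a where "a = y 2 * s 1 - y 1 * s 2"
    define b where "b = y 1 - y 2"
    have line: "y l * (s 1 - s 2) = a + b * s l" if l_range: "l \<in> {1..r+2}" for l
    proof -
      consider "l = 1" | "l = 2" | k where "k < r" "l = k + 3"
      proof -
        assume *: "l = 1 \<Longrightarrow> thesis" "l = 2 \<Longrightarrow> thesis" "\<And>k. k < r \<Longrightarrow> l = k + 3 \<Longrightarrow> thesis"
        show thesis
        proof (cases "l \<le> 2")
          case True
          then have "l = 1 \<or> l = 2" using l_range by auto
          then show thesis using *(1,2) by blast
        next
          case False
          then show thesis using l_range by (intro *(3)[of "l - 3"]) auto
        qed
      qed
      then show ?thesis
      proof cases
        case (3 k)
        define S where "S = {1..r+2}"
        have S: "finite S" "k + 3 \<in> S" "1 \<in> S" "2 \<in> S" using 3(1) by (auto simp: S_def)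
        have "(\<Sum>i\<in>S. A i k * y i) =
            (\<Sum>i\<in>S. if i = k + 3 then (s 1 - s 2) * y i else 0) +
            ((\<Sum>i\<in>S. if i = 1 then (s 2 - s (k + 3)) * y i else 0) +
            (\<Sum>i\<in>S. if i = 2 then (s (k + 3) - s 1) * y i else 0))"
          unfolding sum.distrib[symmetric] by (intro sum.cong refl) (simp add: A_def distrib_right)
        moreover have "(\<Sum>i\<in>S. A i k * y i) = 0" using ker 3(1) by (simp only: S_def)
        ultimately have "(s 1 - s 2) * y l + ((s 2 - s l) * y 1 + (s l - s 1) * y 2) = 0"
          using S by (simp add: 3(2))
        then show ?thesis by (simp add: a_def b_def algebra_simps)
      qed (simp_all add: a_def b_def algebra_simps)
    qed
    have "a + b * s i = 0" "a + b * s i' = 0"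
      using line[OF i(1)] line[OF i(2)] i(4,5) by simp_all
    moreover have "b * (s i - s i') = (a + b * s i) - (a + b * s i')" by (simp add: algebra_simps)
    ultimately have "b * (s i - s i') = 0" by simp
    then have "b = 0" using i(3) by (simp add: s_eq)
    then have "a = 0" using line[OF i(1)] i(4) by simp
    then show "y l = 0" using line[OF l] \<open>b = 0\<close> by (simp add: s_eq)
  qed
qed

text \<open>Writing the elements in the order of their types and wrapping the list around after \<open>c\<close> places
  puts at most two elements in each place.  Two in the same place are exactly \<open>c\<close> apart,
  and a run of equal types has length at most \<open>c\<close>, so their types differ.\<close>

lemma pairing_of_distinct_types:
  fixes \<tau> :: "'a::linorder \<Rightarrow> nat"
  assumes "finite G" and card: "card G \<le> 2 * c" and types: "\<And>i. card {j \<in> G. \<tau> j = i} \<le> c"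
  obtains l where "\<forall>j\<in>G. l j < c"
    and "\<forall>j\<in>G. \<forall>j'\<in>G. j \<noteq> j' \<and> l j = l j' \<longrightarrow> \<tau> j \<noteq> \<tau> j' \<and> {j'' \<in> G. l j'' = l j} = {j, j'}"
proof (cases "c = 0")
  case True
  then show ?thesis using assms that by simp
next
  case False
  define xs where "xs = sort_key \<tau> (sorted_list_of_set G)"
  have xs: "set xs = G" "distinct xs" "length xs = card G" "sorted (map \<tau> xs)"
    using \<open>finite G\<close> by (simp_all add: xs_def)
  define pos where "pos = inv_into {..<card G} ((!) xs)"
  have bij: "bij_betw ((!) xs) {..<card G} G"
    by (rule bij_betw_nth[OF xs(2)]) (simp_all only: xs(1,3))
  have pos: "pos j < card G" "xs ! pos j = j" if "j \<in> G" for j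
    using bij_betw_apply[OF bij_betw_inv_into[OF bij] that] bij_betw_inv_into_right[OF bij that]
    by (simp_all add: pos_def)
  have shift: "q = p + c" if "p < q" "q < card G" "p mod c = q mod c" for p q
  proof -
    have "c dvd q - p"
      using that mod_eq_dvd_iff_nat[of p q c] by simp
    then obtain d where d: "q - p = c * d" by (rule dvdE)
    have "q - p < 2 * c" using that card by linarith
    then have "d < 2" by (simp add: d)
    moreover have "d \<noteq> 0" using d that by (intro notI) simp
    ultimately have "d = 1" by simp
    then show ?thesis using d that by simp
  qed
  have diff: "\<tau> (xs ! p) \<noteq> \<tau> (xs ! q)" if pq: "p < q" "q < card G" "p mod c = q mod c" for p q
  proof
    assume eq: "\<tau> (xs ! p) = \<tau> (xs ! q)"
    have same: "\<tau> (xs ! u) = \<tau> (xs ! p)" if "u \<in> {p..q}" for u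
      using sorted_nth_mono[OF xs(4), of p u] sorted_nth_mono[OF xs(4), of u q] that pq eq xs(3) by simp
    have in_G: "xs ! u \<in> G" if "u \<in> {p..q}" for u
      using bij_betw_apply[OF bij, of u] that pq(2) by simp
    have "(!) xs ` {p..q} \<subseteq> {j \<in> G. \<tau> j = \<tau> (xs ! p)}"
      using same in_G by blast
    then have "card ((!) xs ` {p..q}) \<le> card {j \<in> G. \<tau> j = \<tau> (xs ! p)}"
      using \<open>finite G\<close> by (intro card_mono) simp_all
    then have "card ((!) xs ` {p..q}) \<le> c"
      using types order_trans by blast
    moreover have "inj_on ((!) xs) {p..q}"
      by (rule inj_on_subset[OF bij_betw_imp_inj_on[OF bij]]) (use pq in auto)
    ultimately show False
      using shift[OF pq] by (simp add: card_image)
  qed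
  define l where "l j = pos j mod c" for j
  have third: "j'' \<in> {j, j'}" if "j \<in> G" "j' \<in> G" "j'' \<in> G" "j \<noteq> j'" "l j = l j'" "l j'' = l j" for j j' j''
  proof (rule ccontr)
    assume "j'' \<notin> {j, j'}"
    then have "pos j \<noteq> pos j'" "pos j'' \<noteq> pos j" "pos j'' \<noteq> pos j'"
      using pos that by (metis insert_iff)+
    moreover have far: "pos a = pos b + c \<or> pos b = pos a + c"
      if "a \<in> G" "b \<in> G" "pos a \<noteq> pos b" "l a = l b" for a b
      using shift[of "pos a" "pos b"] shift[of "pos b" "pos a"] pos(1)[of a] pos(1)[of b] that
      by (auto simp: l_def neq_iff)
    ultimately have diffs: "pos j = pos j' + c \<or> pos j' = pos j + c" "pos j'' = pos j + c \<or> pos j = pos j'' + c"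
      "pos j'' = pos j' + c \<or> pos j' = pos j'' + c"
      using that by auto
    have "pos j < 2 * c" "pos j' < 2 * c" "pos j'' < 2 * c"
      using pos(1)[OF that(1)] pos(1)[OF that(2)] pos(1)[OF that(3)] card by linarith+
    with diffs show False
      by (elim disjE) linarith+
  qed
  have "\<tau> j \<noteq> \<tau> j' \<and> {j'' \<in> G. l j'' = l j} = {j, j'}"
    if j: "j \<in> G" "j' \<in> G" "j \<noteq> j'" "l j = l j'" for j j'
  proof
    have "pos j \<noteq> pos j'" using pos j by metis
    then show "\<tau> j \<noteq> \<tau> j'"
      using diff[of "pos j" "pos j'"] diff[of "pos j'" "pos j"] pos[OF j(1)] pos[OF j(2)] j(4)
      by (auto simp: l_def neq_iff)
    show "{j'' \<in> G. l j'' = l j} = {j, j'}"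
      using third[OF j(1,2) _ j(3,4)] j by auto
  qed
  moreover have "\<forall>j\<in>G. l j < c" using False by (simp add: l_def)
  ultimately show ?thesis by (intro that[of l]) blast+
qed

text \<open>The bounds of the last case are what the pairing needs: the unit vectors left over by the full
  columns \<open>F\<close> number \<open>c = r - |F|\<close>, each is used at most twice, and the type of a column is
  the row of its gap.  If two columns \<open>j\<close>, \<open>j'\<close> share a unit vector, then
  \<open>Y (i, j) + Y (i, j') = 0\<close> for all \<open>i\<close>, so column \<open>j\<close> also vanishes in the row of
  the gap of \<open>j'\<close>.\<close>

lemma dense_block_corank_2:
  assumes inf: "infinite (UNIV :: 'k::field set)"
    and ex: "normal_vectors_exist TYPE('k) r (r + 2) n \<Omega>" and \<Omega>: "\<Omega> \<subseteq> {1..r+2} \<times> {1..n}"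
  shows "dense_block r (r + 2) n \<Omega>"
proof -
  let ?m = "r + 2"
  define missing where "missing j = {i \<in> {1..?m}. (i, j) \<notin> \<Omega>}" for j
  define F where "F = {j \<in> {1..n}. missing j = {}}"
  define G where "G = {j \<in> {1..n}. \<exists>i. missing j = {i}}"
  define \<tau> where "\<tau> j = the_elem (missing j)" for j
  define G_of where "G_of i = {j \<in> G. \<tau> j = i}" for i
  have fin: "finite F" "finite G" by (simp_all add: F_def G_def)
  have disj: "F \<inter> G = {}" by (auto simp: F_def G_def)
  have FG: "F \<subseteq> {1..n}" "G \<subseteq> {1..n}" by (auto simp: F_def G_def)
  have G: "missing j = {\<tau> j}" if "j \<in> G" for j
  proof -
    obtain i where "missing j = {i}" using \<open>j \<in> G\<close> by (auto simp: G_def)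
    then show ?thesis by (simp add: \<tau>_def)
  qed
  have \<tau>: "\<tau> j \<in> {1..?m}" "(\<tau> j, j) \<notin> \<Omega>" if "j \<in> G" for j
    using G[OF that] unfolding missing_def by blast+
  have in\<Omega>: "(i, j) \<in> \<Omega>" if "i \<in> {1..?m}" "i \<notin> missing j" for i j
    using that by (auto simp: missing_def)
  show ?thesis
  proof (cases "\<exists>i\<in>{1..?m}. r < card F + card (G_of i)")
    case True
    then obtain i where i: "i \<in> {1..?m}" "r < card F + card (G_of i)" by blast
    let ?I = "{1..?m} - {i}" and ?J = "F \<union> G_of i"
    have I: "card ?I = r + 1" using i(1) by simp
    have J: "card ?J = card F + card (G_of i)"
      using disj fin by (intro card_Un_disjoint) (auto simp: G_of_def)
    have "a \<notin> missing b" if "a \<in> ?I" "b \<in> ?J" for a b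
      using that G[of b] by (auto simp: F_def G_of_def)
    then have empty: "?I \<times> ?J - \<Omega> = {}"
      using in\<Omega> by blast
    show ?thesis
    proof (rule dense_blockI)
      show "?I \<subseteq> {1..?m}" "?J \<subseteq> {1..n}" using FG by (auto simp: G_of_def)
      show "r < card ?I" "r < card ?J" using I J i(2) by simp_all
      show "card (?I \<times> ?J - \<Omega>) < (card ?I - r) * (card ?J - r)"
        unfolding empty I J using i(2) by simp
    qed
  next
    case few: False
    show ?thesis
    proof (cases "2 * r < 2 * card F + card G")
      case True
      have J: "card (F \<union> G) = card F + card G" using disj fin by (intro card_Un_disjoint)
      have "{1..?m} \<times> (F \<union> G) - \<Omega> \<subseteq> (\<lambda>j. (\<tau> j, j)) ` G"
        using in\<Omega> G by (force simp: F_def)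
      then have "card ({1..?m} \<times> (F \<union> G) - \<Omega>) \<le> card G"
        using fin(2) by (rule surj_card_le[rotated])
      then show ?thesis
        using True J FG by (intro dense_blockI[of "{1..?m}" _ "F \<union> G"]) auto
    next
      case False
      define c where "c = r - card F"
      have few': "card F + card (G_of i) \<le> r" if "i \<in> {1..?m}" for i
        using few that not_less by blast
      have "card F + card (G_of 1) \<le> r" by (rule few') simp
      then have F_le: "card F \<le> r" by simp
      have G_le: "card G \<le> 2 * c" using False F_le by (simp add: c_def)
      have types: "card {j \<in> G. \<tau> j = i} \<le> c" for i
      proof (cases "i \<in> {1..?m}")
        case True
        then show ?thesis using few'[of i] F_le by (simp add: c_def G_of_def)
      next
        case False
        then have "{j \<in> G. \<tau> j = i} = {}" using \<tau>(1) by blast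
        then show ?thesis by (simp only: card.empty)
      qed
      obtain g where g: "\<forall>j\<in>G. g j < c"
        and pair: "\<forall>j\<in>G. \<forall>j'\<in>G. j \<noteq> j' \<and> g j = g j' \<longrightarrow>
          \<tau> j \<noteq> \<tau> j' \<and> {j'' \<in> G. g j'' = g j} = {j, j'}"
        by (rule pairing_of_distinct_types[OF fin(2) G_le types])
      obtain h where h: "bij_betw h F {0..<card F}"
        using ex_bij_betw_finite_nat[OF fin(1)] by blast
      define l where "l j = (if j \<in> F then h j else card F + g j)" for j
      have hF: "h j < card F" if "j \<in> F" for j
        using bij_betw_apply[OF h that] by simp
      have l_lt: "l j < r" if "j \<in> F \<union> G" for j
        using that hF g F_le by (fastforce simp: l_def c_def)
      have fiber_F: "{j' \<in> F \<union> G. l j' = l j} = {j}" if "j \<in> F" for j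
        using that hF[OF that] disj bij_betw_imp_inj_on[OF h] by (auto simp: l_def inj_on_eq_iff)
      have fiber_G: "{j' \<in> F \<union> G. l j' = l j} = {j' \<in> G. g j' = g j}" if "j \<in> G" for j
      proof -
        have "l j' = card F + g j'" if "j' \<in> G" for j' using that disj by (auto simp: l_def)
        moreover have "l j' < card F" if "j' \<in> F" for j' using that hF by (simp add: l_def)
        ultimately show ?thesis using that by fastforce
      qed
      obtain A :: "nat \<Rightarrow> nat \<Rightarrow> 'k" where A: "\<forall>y. (\<forall>k<r. (\<Sum>i=1..?m. A i k * y i) = 0) \<longrightarrow>
          (\<forall>i\<in>{1..?m}. \<forall>i'\<in>{1..?m}. i \<noteq> i' \<and> y i = 0 \<and> y i' = 0 \<longrightarrow> (\<forall>l\<in>{1..?m}. y l = 0))"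
        by (rule two_dimensional_kernel[OF inf, where r = r])
      define B :: "nat \<Rightarrow> nat \<Rightarrow> 'k" where "B k j = (if j \<in> F \<union> G \<and> l j = k then 1 else 0)" for k j
      obtain Y where Y: "\<exists>w\<in>\<Omega>. Y w \<noteq> 0" and Y_out: "\<forall>w. w \<notin> \<Omega> \<longrightarrow> Y w = 0"
        and rows: "\<forall>i\<in>{1..?m}. \<forall>k<r. (\<Sum>j=1..n. B k j * Y (i, j)) = 0"
        and cols: "\<forall>j\<in>{1..n}. \<forall>k<r. (\<Sum>i=1..?m. A i k * Y (i, j)) = 0"
        by (rule normal_vectors_existE[OF ex, where B = B and A = A])
      have column_zero: "Y (i'', j) = 0"
        if "j \<in> {1..n}" "i \<in> {1..?m}" "i' \<in> {1..?m}" "i \<noteq> i'" "Y (i, j) = 0" "Y (i', j) = 0" "i'' \<in> {1..?m}"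
        for i i' i'' j
        using A[rule_format, of "\<lambda>i. Y (i, j)" i i' i''] cols that by blast
      have fiber_sum: "(\<Sum>j' \<in> {j' \<in> F \<union> G. l j' = l j}. Y (i, j')) = 0"
        if "j \<in> F \<union> G" "i \<in> {1..?m}" for i j
      proof -
        have "(\<Sum>j'=1..n. B (l j) j' * Y (i, j')) = (\<Sum>j' \<in> {j' \<in> F \<union> G. l j' = l j}. Y (i, j'))"
          using FG by (intro sum.mono_neutral_cong_right) (auto simp: B_def)
        then show ?thesis using rows that(2) l_lt[OF that(1)] by simp
      qed
      have zero: "Y (i, j) = 0" if i: "i \<in> {1..?m}" and j: "j \<in> {1..n}" for i j
      proof -
        consider "j \<in> F" | "j \<in> G" | "j \<notin> F" "j \<notin> G" by blast
        then show ?thesis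
        proof cases
          case 1
          then show ?thesis using fiber_sum[of j i] fiber_F[of j] i by simp
        next
          case jG: 2
          show ?thesis
          proof (cases "\<exists>j'\<in>G. j' \<noteq> j \<and> g j' = g j")
            case True
            then obtain j' where j': "j' \<in> G" "j \<noteq> j'" "g j = g j'" by metis
            have ne: "\<tau> j \<noteq> \<tau> j'" and fiber: "{j'' \<in> G. g j'' = g j} = {j, j'}"
              using pair jG j' by blast+
            have "Y (\<tau> j', j) + Y (\<tau> j', j') = 0"
              using fiber_sum[of j "\<tau> j'"] fiber_G[OF jG] fiber \<tau>[OF j'(1)] jG j'(2) by simp
            then have "Y (\<tau> j', j) = 0" using Y_out \<tau>(2)[OF j'(1)] by simp
            then show ?thesis
              using column_zero[OF j \<tau>(1)[OF jG] \<tau>(1)[OF j'(1)] ne] Y_out \<tau>(2)[OF jG] i by blast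
          next
            case False
            then have "{j'' \<in> G. g j'' = g j} = {j}" using jG by auto
            then show ?thesis using fiber_sum[of j i] fiber_G[OF jG] jG i by simp
          qed
        next
          case 3
          then have "missing j \<noteq> {}" "\<nexists>i. missing j = {i}" using j by (auto simp: F_def G_def)
          then obtain i1 i2 where i12: "i1 \<in> missing j" "i2 \<in> missing j" "i1 \<noteq> i2" by blast
          then show ?thesis
            using column_zero[OF j, of i1 i2] Y_out i by (auto simp: missing_def)
        qed
      qed
      then show ?thesis using Y \<Omega> by blast
    qed
  qed
qed

text \<open>An empty row is added to reach the previous case.  A dense block that contains the empty row has
  \<open>|J|\<close> gaps there, and since \<open>|J| \<ge> |J| - r\<close> it stays dense without that row.\<close>

lemma dense_block_corank_1:
  assumes inf: "infinite (UNIV :: 'k::field set)"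
    and ex: "normal_vectors_exist TYPE('k) r (r + 1) n \<Omega>" and \<Omega>: "\<Omega> \<subseteq> {1..r+1} \<times> {1..n}"
  shows "dense_block r (r + 1) n \<Omega>"
proof -
  have ground: "{1..r+2} = insert (r + 2) {1..r+1}" by auto
  have out: "(r + 2, j) \<notin> \<Omega>" for j using \<Omega> by auto
  have "normal_vectors_exist TYPE('k) r (r + 2) n \<Omega>"
    unfolding normal_vectors_exist_def
  proof (intro allI)
    fix A B :: "nat \<Rightarrow> nat \<Rightarrow> 'k"
    obtain Y where Y: "\<exists>w\<in>\<Omega>. Y w \<noteq> 0" "\<forall>w. w \<notin> \<Omega> \<longrightarrow> Y w = 0"
      "\<forall>i\<in>{1..r+1}. \<forall>k<r. (\<Sum>j=1..n. B k j * Y (i, j)) = 0"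
      "\<forall>j\<in>{1..n}. \<forall>k<r. (\<Sum>i=1..r+1. A i k * Y (i, j)) = 0"
      by (rule normal_vectors_existE[OF ex, where B = B and A = A])
    have last: "Y (r + 2, j) = 0" for j using Y(2) out by blast
    have "\<forall>i\<in>{1..r+2}. \<forall>k<r. (\<Sum>j=1..n. B k j * Y (i, j)) = 0"
      unfolding ground using Y(3) last by auto
    moreover have "\<forall>j\<in>{1..n}. \<forall>k<r. (\<Sum>i=1..r+2. A i k * Y (i, j)) = 0"
      unfolding ground using Y(4) last by simp
    ultimately show "\<exists>Y. (\<exists>w\<in>\<Omega>. Y w \<noteq> 0) \<and> (\<forall>w. w \<notin> \<Omega> \<longrightarrow> Y w = 0) \<and>
      (\<forall>i\<in>{1..r+2}. \<forall>k<r. (\<Sum>j=1..n. B k j * Y (i, j)) = 0) \<and>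
      (\<forall>j\<in>{1..n}. \<forall>k<r. (\<Sum>i=1..r+2. A i k * Y (i, j)) = 0)"
      using Y(1,2) by blast
  qed
  moreover have "\<Omega> \<subseteq> {1..r+2} \<times> {1..n}" using \<Omega> ground by blast
  ultimately have "dense_block r (r + 2) n \<Omega>"
    by (rule dense_block_corank_2[OF inf])
  then obtain I J where I: "I \<subseteq> {1..r+2}" and J: "J \<subseteq> {1..n}" and IJ: "r < card I" "r < card J"
    and block: "card (I \<times> J - \<Omega>) < (card I - r) * (card J - r)"
    unfolding dense_block_def by blast
  have fin: "finite I" "finite J" using I J by (auto intro: finite_subset)
  show ?thesis
  proof (cases "r + 2 \<in> I")
    case False
    then have "I \<subseteq> {1..r+1}" using I unfolding ground by blast
    then show ?thesis using J IJ block by (rule dense_blockI)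
  next
    case True
    let ?I = "I - {r + 2}"
    have split: "I \<times> J - \<Omega> = (?I \<times> J - \<Omega>) \<union> {r + 2} \<times> J"
      using True out by auto
    have "card (I \<times> J - \<Omega>) = card (?I \<times> J - \<Omega>) + card J"
      unfolding split using fin by (subst card_Un_disjoint) (auto simp: card_cartesian_product)
    then have less: "card (?I \<times> J - \<Omega>) + card J < (card I - r) * (card J - r)"
      using block by simp
    have cI: "card ?I = card I - 1" using True fin by simp
    obtain a where a: "card I = r + 1 + a" using IJ(1) by (metis Suc_eq_plus1 Suc_leI le_Suc_ex)
    have "a \<noteq> 0"
    proof
      assume "a = 0"
      then show False using less a by simp
    qed
    then have "r < card ?I" using cI a by simp
    moreover have "card (?I \<times> J - \<Omega>) < (card ?I - r) * (card J - r)"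
      using less cI a by simp
    moreover have "?I \<subseteq> {1..r+1}" using I unfolding ground by blast
    ultimately show ?thesis using J IJ by (intro dense_blockI)
  qed
qed

lemma dense_block_exists:
  assumes inf: "infinite (UNIV :: 'k::field set)"
    and ex: "normal_vectors_exist TYPE('k) r m n \<Omega>" and \<Omega>: "\<Omega> \<subseteq> {1..m} \<times> {1..n}"
    and r: "r < min m n" "r = 1 \<or> min m n \<le> r + 2"
  shows "dense_block r m n \<Omega>"
proof -
  have thin: "dense_block r m n \<Omega>"
    if "normal_vectors_exist TYPE('k) r m n \<Omega>" "\<Omega> \<subseteq> {1..m} \<times> {1..n}" "r < m" "m \<le> r + 2" for m n \<Omega>
  proof -
    have "m = r + 1 \<or> m = r + 2" using that by linarith
    then show ?thesis
      using dense_block_corank_1[OF inf] dense_block_corank_2[OF inf] that by blast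
  qed
  have \<Omega>': "\<Omega>\<inverse> \<subseteq> {1..n} \<times> {1..m}" using \<Omega> by blast
  consider "r = 1" | "m \<le> r + 2" | "n \<le> r + 2" using r(2) by linarith
  then show ?thesis
  proof cases
    case 1
    then show ?thesis using dense_block_rank_1[of m n \<Omega>] ex \<Omega> by blast
  next
    case 2
    then show ?thesis using thin[OF ex \<Omega>] r(1) by simp
  next
    case 3
    then show ?thesis
      using dense_block_transpose[OF thin[OF normal_vectors_exist_transpose[OF ex] \<Omega>']] r(1) by simp
  qed
qed

section \<open>Existence of certificates for dependence\<close>

theorem proposition5p16:
  fixes r m n :: nat and \<Omega> :: "(nat \<times> nat) set"
  assumes "infinite (UNIV :: 'k::field set)"
    and "0 < r" and "r < min m n"
    and "r = 1 \<or> min m n \<le> r + 2"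
    and "det_matroid_dep TYPE('k) r m n \<Omega>"
  shows "(\<exists>T \<subseteq> {1..m} \<times> {1..n}.
            ideal_height (poly_ring_on T :: (nat \<times> nat, 'k) mpolynomial ring) (det_ideal (r + 1) T)
              > enat (card (T - \<Omega>)))
       \<and> (\<exists>s \<ge> (1::nat). \<exists>I J :: nat \<Rightarrow> nat set.
            (\<forall>\<alpha>\<in>{1..s}. I \<alpha> \<times> J \<alpha> \<subseteq> {1..m} \<times> {1..n} \<and> card (I \<alpha>) > r \<and> card (J \<alpha>) > r) \<and>
            (\<forall>\<alpha>. 1 < \<alpha> \<and> \<alpha> \<le> s \<longrightarrow>
               (\<exists>I' J'. I' \<subseteq> {1..m} \<and> J' \<subseteq> {1..n} \<and> min (card I') (card J') \<le> r \<and>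
                  (I \<alpha> \<times> J \<alpha>) \<inter> (\<Union>k\<in>{1..<\<alpha>}. I k \<times> J k) \<subseteq> I' \<times> J')) \<and>
            card ((\<Union>\<alpha>\<in>{1..s}. I \<alpha> \<times> J \<alpha>) - \<Omega>)
              < (\<Sum>\<alpha>=1..s. (card (I \<alpha>) - r) * (card (J \<alpha>) - r)))"
proof -
  have \<Omega>: "\<Omega> \<subseteq> {1..m} \<times> {1..n}"
    using assms(5) by (simp add: det_matroid_dep_def det_matroid_ground_def)
  have "dense_block r m n \<Omega>"
    by (rule dense_block_exists[OF assms(1) dependent_imp_normal_vectors_exist[OF assms(5)] \<Omega> assms(3,4)])
  then obtain I J where I: "I \<subseteq> {1..m}" and J: "J \<subseteq> {1..n}" and card: "r < card I" "r < card J"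
    and block: "card (I \<times> J - \<Omega>) < (card I - r) * (card J - r)"
    unfolding dense_block_def by blast
  have fin: "finite I" "finite J" using finite_subset[OF I] finite_subset[OF J] by simp_all
  have IJ: "I \<times> J \<subseteq> {1..m} \<times> {1..n}" using I J by (rule Sigma_mono)
  let ?R = "poly_ring_on (I \<times> J) :: (nat \<times> nat, 'k) mpolynomial ring"
  have "enat (card (I \<times> J - \<Omega>)) < enat ((card I - r) * (card J - r))"
    using block by simp
  also have "\<dots> \<le> ideal_height ?R (det_ideal (r + 1) (I \<times> J))"
    by (rule ideal_height_det_ideal_ge[OF fin])
  finally have "ideal_height ?R (det_ideal (r + 1) (I \<times> J)) > enat (card (I \<times> J - \<Omega>))" .
  then show ?thesis
    using IJ card block
    by (intro conjI exI[of _ "I \<times> J"] exI[of _ "1::nat"] exI[of _ "\<lambda>_. I"] exI[of _ "\<lambda>_. J"]) auto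
qed

end
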